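(* Consider graphs $\mathcal{G}=(V,E)$ with maximum degree $\Delta_{\mathcal{G}}\le 3$ whose nodes carry independent random weights $W_i$, $i\in V$, each exponentially distributed with parameter $1$. Then there exists a multiplicative EPTAS for finding $J_{\mathcal{G}}$, the maximum weight of an independent set of $\mathcal{G}$, with high probability. The algorithm runs in time $O\big(|V|\,2^{O(\epsilon^{-2}\log(1/\epsilon))}\big)$.
   Context: For a graph $(V,E)$ with node weights $W_i\ge 0$, an independent set is a set $I\subset V$ containing no two adjacent nodes; its weight is $W(I)=\sum_{i\in I}W_i$, and $J_{\mathcal{G}}=\max_I W(I)$ over independent sets $I$. The graph is arbitrary (worst case); the weights are random and their realization is observed and is part of the input. An algorithm (possibly randomized) is a multiplicative EPTAS with high probability for finding $J_{\mathcal{G}}$ if for every $\epsilon>0$ it outputs, in time $O(|V|^{O(1)}g(\epsilon))$ for some function $g$ independent of $|V|$, an independent set $\hat I$ such that $\mathbb{P}(J_{\mathcal{G}}/W(\hat I)>1+\epsilon)\le\epsilon$ (probability over the weights and any internal randomness of the algorithm). *)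

theory Defs
  imports "HOL-Probability.Probability" "Graph_Theory.Pair_Digraph"
begin

section \<open>Maximum weight independent sets\<close>

text \<open>
  A finite simple graph is a \<open>pair_graph\<close>: finitely many vertices, a symmetric loop-free arc
  relation, and hence \<open>out_degree\<close> as the degree.
\<close>

definition max_degree :: "'a pair_pre_digraph \<Rightarrow> nat" where
  "max_degree G = Max (insert 0 (out_degree (with_proj G) ` pverts G))"

definition independent_set :: "'a pair_pre_digraph \<Rightarrow> 'a set \<Rightarrow> bool" where
  "independent_set G I \<longleftrightarrow> I \<subseteq> pverts G \<and> (\<forall>u\<in>I. \<forall>v\<in>I. (u, v) \<notin> parcs G)"

definition set_weight :: "('a \<Rightarrow> real) \<Rightarrow> 'a set \<Rightarrow> real" where
  "set_weight w I = (\<Sum>i\<in>I. w i)"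

definition max_indep_weight :: "'a pair_pre_digraph \<Rightarrow> ('a \<Rightarrow> real) \<Rightarrow> real" where
  "max_indep_weight G w = Max (set_weight w ` {I. independent_set G I})"


section \<open>Randomized real RAM\<close>

text \<open>
  Algorithms are the programs of a small imperative language over two sorts of zero-initialised,
  indirectly addressable memory, one holding naturals and one holding reals; a scalar variable is
  an array used at a fixed index only. Every assignment, coin flip, output command and test of a
  condition costs one unit. The number of operations in an expression is fixed by the program
  text, so charging for each operation separately would change running times only by a constant
  factor depending on the program.

  The machine is kept deliberately weak, so that unit costs are not a source of spurious power:
  naturals can only be added, subtracted and compared; reals admit field operations and
  comparisons, but there is no rounding from reals to naturals and there are no real constants
  besides the images of naturals; randomness consists of fair coin flips.

  The input (number of vertices, adjacency lists, weights, accuracy) is read-only with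
  unit-cost access. The output is a set of vertices, emitted element by element.
\<close>

record mwis_input =
  num_verts :: nat
  nbrs :: "nat \<Rightarrow> nat list"
  wgt :: "nat \<Rightarrow> real"
  accuracy :: real

type_synonym aname = string

datatype nexp =
    NConst nat
  | NGet aname nexp
  | NAdd nexp nexp
  | NSub nexp nexp
  | NumVerts
  | Deg nexp
  | Nbr nexp nexp

datatype rexp =
    OfNat nexp
  | RGet aname nexp
  | RAdd rexp rexp
  | RSub rexp rexp
  | RMul rexp rexp
  | RDiv rexp rexp
  | Weight nexp
  | Accuracy

datatype bexp =
    NLess nexp nexp
  | RLess rexp rexp
  | BNot bexp
  | BAnd bexp bexp

datatype com =
    Skip
  | NSet aname nexp nexp
  | RSet aname nexp rexp
  | Flip aname nexp
  | Emit nexp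
  | Seq com com
  | Cond bexp com com
  | While bexp com

record state =
  nmem :: "aname \<Rightarrow> nat \<Rightarrow> nat"
  rmem :: "aname \<Rightarrow> nat \<Rightarrow> real"
  flips :: nat
  emitted :: "nat set"

definition init_state :: state where
  "init_state = \<lparr>nmem = (\<lambda>_ _. 0), rmem = (\<lambda>_ _. 0), flips = 0, emitted = {}\<rparr>"

primrec nval :: "mwis_input \<Rightarrow> state \<Rightarrow> nexp \<Rightarrow> nat" where
  "nval inp s (NConst k) = k"
| "nval inp s (NGet a e) = nmem s a (nval inp s e)"
| "nval inp s (NAdd e1 e2) = nval inp s e1 + nval inp s e2"
| "nval inp s (NSub e1 e2) = nval inp s e1 - nval inp s e2"
| "nval inp s NumVerts = num_verts inp"
| "nval inp s (Deg e) =
    (let v = nval inp s e in if v < num_verts inp then length (nbrs inp v) else 0)"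
| "nval inp s (Nbr e1 e2) =
    (let v = nval inp s e1; k = nval inp s e2
     in if v < num_verts inp \<and> k < length (nbrs inp v) then nbrs inp v ! k else 0)"

primrec rval :: "mwis_input \<Rightarrow> state \<Rightarrow> rexp \<Rightarrow> real" where
  "rval inp s (OfNat e) = real (nval inp s e)"
| "rval inp s (RGet a e) = rmem s a (nval inp s e)"
| "rval inp s (RAdd e1 e2) = rval inp s e1 + rval inp s e2"
| "rval inp s (RSub e1 e2) = rval inp s e1 - rval inp s e2"
| "rval inp s (RMul e1 e2) = rval inp s e1 * rval inp s e2"
| "rval inp s (RDiv e1 e2) = rval inp s e1 / rval inp s e2"
| "rval inp s (Weight e) =
    (let v = nval inp s e in if v < num_verts inp then wgt inp v else 0)"
| "rval inp s Accuracy = accuracy inp"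

primrec bval :: "mwis_input \<Rightarrow> state \<Rightarrow> bexp \<Rightarrow> bool" where
  "bval inp s (NLess e1 e2) \<longleftrightarrow> nval inp s e1 < nval inp s e2"
| "bval inp s (RLess e1 e2) \<longleftrightarrow> rval inp s e1 < rval inp s e2"
| "bval inp s (BNot b) \<longleftrightarrow> \<not> bval inp s b"
| "bval inp s (BAnd b1 b2) \<longleftrightarrow> bval inp s b1 \<and> bval inp s b2"

text \<open>
  \<open>exec inp \<omega> c s t s'\<close>: on input \<open>inp\<close> and with coin sequence \<open>\<omega>\<close>, the program \<open>c\<close> started in
  state \<open>s\<close> halts in state \<open>s'\<close> after exactly \<open>t\<close> steps.
\<close>

inductive exec ::
  "mwis_input \<Rightarrow> (nat \<Rightarrow> bool) \<Rightarrow> com \<Rightarrow> state \<Rightarrow> nat \<Rightarrow> state \<Rightarrow> bool"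
  for inp :: mwis_input and \<omega> :: "nat \<Rightarrow> bool"
where
  exec_Skip: "exec inp \<omega> Skip s 1 s"
| exec_NSet: "exec inp \<omega> (NSet a i e) s 1
    (s\<lparr>nmem := (nmem s)(a := (nmem s a)(nval inp s i := nval inp s e))\<rparr>)"
| exec_RSet: "exec inp \<omega> (RSet a i e) s 1
    (s\<lparr>rmem := (rmem s)(a := (rmem s a)(nval inp s i := rval inp s e))\<rparr>)"
| exec_Flip: "exec inp \<omega> (Flip a i) s 1
    (s\<lparr>nmem := (nmem s)(a := (nmem s a)(nval inp s i := of_bool (\<omega> (flips s)))),
       flips := Suc (flips s)\<rparr>)"
| exec_Emit: "exec inp \<omega> (Emit e) s 1 (s\<lparr>emitted := insert (nval inp s e) (emitted s)\<rparr>)"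
| exec_Seq: "exec inp \<omega> c1 s t1 s1 \<Longrightarrow> exec inp \<omega> c2 s1 t2 s2 \<Longrightarrow>
    exec inp \<omega> (Seq c1 c2) s (t1 + t2) s2"
| exec_CondTrue: "bval inp s b \<Longrightarrow> exec inp \<omega> c1 s t s' \<Longrightarrow>
    exec inp \<omega> (Cond b c1 c2) s (Suc t) s'"
| exec_CondFalse: "\<not> bval inp s b \<Longrightarrow> exec inp \<omega> c2 s t s' \<Longrightarrow>
    exec inp \<omega> (Cond b c1 c2) s (Suc t) s'"
| exec_WhileFalse: "\<not> bval inp s b \<Longrightarrow> exec inp \<omega> (While b c) s 1 s"
| exec_WhileTrue: "bval inp s b \<Longrightarrow> exec inp \<omega> c s t1 s1 \<Longrightarrow>
    exec inp \<omega> (While b c) s1 t2 s2 \<Longrightarrow> exec inp \<omega> (While b c) s (Suc (t1 + t2)) s2"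

inductive_cases exec_SkipE: "exec inp \<omega> Skip s t s'"
inductive_cases exec_NSetE: "exec inp \<omega> (NSet a i e) s t s'"
inductive_cases exec_RSetE: "exec inp \<omega> (RSet a i e) s t s'"
inductive_cases exec_FlipE: "exec inp \<omega> (Flip a i) s t s'"
inductive_cases exec_EmitE: "exec inp \<omega> (Emit e) s t s'"
inductive_cases exec_SeqE: "exec inp \<omega> (Seq c1 c2) s t s'"
inductive_cases exec_CondE: "exec inp \<omega> (Cond b c1 c2) s t s'"
inductive_cases exec_WhileE: "exec inp \<omega> (While b c) s t s'"

lemma exec_deterministic:
  "exec inp \<omega> c s t s1 \<Longrightarrow> exec inp \<omega> c s u s2 \<Longrightarrow> u = t \<and> s2 = s1"
proof (induction arbitrary: u s2 rule: exec.induct)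
  case (exec_Seq c1 s t1 s1 c2 t2 s2')
  show ?case by (rule exec_SeqE[OF exec_Seq.prems]) (use exec_Seq.IH in metis)
next
  case (exec_CondTrue s b c1 t s' c2)
  show ?case
    by (rule exec_CondE[OF exec_CondTrue.prems]) (use exec_CondTrue.IH exec_CondTrue.hyps in metis)+
next
  case (exec_CondFalse s b c2 t s' c1)
  show ?case
    by (rule exec_CondE[OF exec_CondFalse.prems]) (use exec_CondFalse.IH exec_CondFalse.hyps in metis)+
next
  case (exec_WhileFalse s b c)
  show ?case
    by (rule exec_WhileE[OF exec_WhileFalse.prems]) (use exec_WhileFalse.hyps in simp_all)
next
  case (exec_WhileTrue s b c t1 s1 t2 s2')
  show ?case
    by (rule exec_WhileE[OF exec_WhileTrue.prems]) (use exec_WhileTrue.IH exec_WhileTrue.hyps in metis)+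
next
  case exec_Skip
  show ?case by (rule exec_SkipE[OF exec_Skip]) simp
next
  case exec_NSet
  show ?case by (rule exec_NSetE[OF exec_NSet]) simp
next
  case exec_RSet
  show ?case by (rule exec_RSetE[OF exec_RSet]) simp
next
  case exec_Flip
  show ?case by (rule exec_FlipE[OF exec_Flip]) simp
next
  case exec_Emit
  show ?case by (rule exec_EmitE[OF exec_Emit]) simp
qed

definition outputs ::
  "com \<Rightarrow> mwis_input \<Rightarrow> (nat \<Rightarrow> bool) \<Rightarrow> nat \<Rightarrow> nat set \<Rightarrow> bool" where
  "outputs alg inp \<omega> t I \<longleftrightarrow> (\<exists>s. exec inp \<omega> alg init_state t s \<and> emitted s = I)"


section \<open>Approximation schemes with high probability\<close>

text \<open>
  As inputs to algorithms, graphs have vertex set \<open>{..<n}\<close> and are presented by adjacency lists,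
  each in arbitrary (worst-case) order.
\<close>

definition presents_graph ::
  "nat \<Rightarrow> (nat \<Rightarrow> nat list) \<Rightarrow> nat pair_pre_digraph \<Rightarrow> bool" where
  "presents_graph n adj G \<longleftrightarrow> pair_graph G \<and> pverts G = {..<n} \<and>
     (\<forall>v<n. distinct (adj v) \<and> set (adj v) = {u. (v, u) \<in> parcs G})"

definition input_of :: "nat \<Rightarrow> (nat \<Rightarrow> nat list) \<Rightarrow> (nat \<Rightarrow> real) \<Rightarrow> real \<Rightarrow> mwis_input" where
  "input_of n adj w \<epsilon> = \<lparr>num_verts = n, nbrs = adj, wgt = w, accuracy = \<epsilon>\<rparr>"

text \<open>
  For every input with non-negative weights and every coin sequence, the algorithm halts within
  \<open>T n \<epsilon>\<close> steps and its output is an independent set.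
\<close>

definition finds_indep_set_within ::
  "com \<Rightarrow> (nat pair_pre_digraph \<Rightarrow> bool) \<Rightarrow> (nat \<Rightarrow> real \<Rightarrow> real) \<Rightarrow> bool" where
  "finds_indep_set_within alg GC T \<longleftrightarrow>
     (\<forall>\<epsilon>>0. \<forall>n adj G w \<omega>. presents_graph n adj G \<longrightarrow> GC G \<longrightarrow> (\<forall>i<n. 0 \<le> w i) \<longrightarrow>
        (\<exists>t I. outputs alg (input_of n adj w \<epsilon>) \<omega> t I \<and> independent_set G I \<and> real t \<le> T n \<epsilon>))"

text \<open>
  The probability space of an algorithm run: i.i.d. vertex weights with law \<open>D\<close>, and an
  independent sequence of fair coins.
\<close>

definition run_space :: "nat \<Rightarrow> real measure \<Rightarrow> ((nat \<Rightarrow> real) \<times> (nat \<Rightarrow> bool)) measure" where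
  "run_space n D =
     (\<Pi>\<^sub>M i\<in>{..<n}. D) \<Otimes>\<^sub>M (\<Pi>\<^sub>M k\<in>(UNIV :: nat set). measure_pmf (bernoulli_pmf (1/2)))"

text \<open>
  The ratio is taken in \<open>ennreal\<close>, so that a zero-weight output counts as a failure
  (ratio \<open>\<infinity>\<close>) whenever the optimum is positive. Here \<open>0 / 0 = 0\<close>, so an optimum of
  zero is never a failure.
\<close>

definition bad_runs ::
  "com \<Rightarrow> nat \<Rightarrow> (nat \<Rightarrow> nat list) \<Rightarrow> nat pair_pre_digraph \<Rightarrow> real measure \<Rightarrow> real \<Rightarrow>
    ((nat \<Rightarrow> real) \<times> (nat \<Rightarrow> bool)) set" where
  "bad_runs alg n adj G D \<epsilon> =
     {(w, \<omega>) \<in> space (run_space n D). \<exists>t I. outputs alg (input_of n adj w \<epsilon>) \<omega> t I \<and>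
        ennreal (max_indep_weight G w) / ennreal (set_weight w I) > ennreal (1 + \<epsilon>)}"

text \<open>
  \<open>GC\<close> is the class of admissible graphs and \<open>D\<close> the weight distribution. Measurability of
  the failure event is demanded explicitly because \<open>measure\<close> is 0 on non-measurable sets.
  The constant of the outer \<open>O\<close> is absorbed in \<open>g\<close>; \<open>max 1 n\<close> only matters for the
  empty graph, where even halting takes a step.
\<close>

definition multiplicative_EPTAS_whp ::
  "com \<Rightarrow> (nat pair_pre_digraph \<Rightarrow> bool) \<Rightarrow> real measure \<Rightarrow> bool" where
  "multiplicative_EPTAS_whp alg GC D \<longleftrightarrow>
     (\<exists>k::nat. \<exists>g::real \<Rightarrow> real.
        finds_indep_set_within alg GC (\<lambda>n \<epsilon>. real (max 1 n) ^ k * g \<epsilon>)) \<and>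
     (\<forall>\<epsilon>>0. \<forall>n adj G. presents_graph n adj G \<longrightarrow> GC G \<longrightarrow>
        bad_runs alg n adj G D \<epsilon> \<in> sets (run_space n D) \<and>
        measure (run_space n D) (bad_runs alg n adj G D \<epsilon>) \<le> \<epsilon>)"

definition exponential_law :: "real \<Rightarrow> real measure" where
  "exponential_law l = density lborel (\<lambda>x. ennreal (exponential_density l x))"

end

theory Submission
  imports Defs
begin

text \<open>
  Write \<open>J(R)\<close> for the largest weight of an independent subset of \<open>R\<close>. Deleting a vertex \<open>v\<close> from \<open>R\<close>
  costs \<open>J(R) - J(R - v) = max 0 (x v - S)\<close>, where \<open>S = J(R - v) - J(R - v - N(v))\<close> is the cost
  of deleting the neighbours of \<open>v\<close> as well. Deleting these one after another expresses \<open>S\<close> as a sum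
  of at most three costs of the same kind, in smaller graphs. Unfolding this recursion to depth \<open>d\<close>
  gives a number \<open>cav d\<close> that depends only on the weights near \<open>v\<close>; it bounds \<open>S\<close> from below
  for even \<open>d\<close> and from above for odd \<open>d\<close> (\<open>cav_sandwich\<close>). A vertex with \<open>x v > S\<close> lies in
  every optimal set, so taking the vertices whose weight exceeds an odd truncation yields a subset of an
  optimal set, which is therefore independent. The weight lost is at most that of the vertices whose weight
  falls between two consecutive truncations (\<open>chosen_loss\<close>).

  Such vertices are rare because the recursion forgets its truncation depth. Except at its
  root, a call concerns a vertex one of whose neighbours has been deleted, so it has at most two
  children. For an exponential weight \<open>Y\<close> independent of \<open>c\<close> and \<open>c'\<close>, the mean distance of
  \<open>exp (- max 0 (Y - c))\<close> and \<open>exp (- max 0 (Y - c'))\<close> is exactly half the distance of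
  \<open>exp (- c)\<close> and \<open>exp (- c')\<close> (\<open>contraction\<close>). Two children with factor one half each give
  only a factor 1 per level. To make it smaller than 1, the recursion is run on the weights
  \<open>w v - \<tau>\<close>: the shift multiplies every level by \<open>exp (- \<tau>)\<close> (\<open>gap_decay\<close>) and changes the weight
  of an independent set by at most \<open>\<tau>\<close> per vertex. With \<open>\<tau> = \<epsilon> / 32\<close> and depth of order \<open>\<epsilon>\<^sup>-\<^sup>2\<close>, both the
  shift and the undecided vertices cost a small multiple of \<open>\<epsilon> n\<close>. This is a small fraction of the optimum,
  because an independent set always carries a quarter of the total weight (\<open>opt_ge_quarter\<close>), which is
  rarely below \<open>n / 2\<close> (\<open>lower_tail_sum\<close>).

  The last estimate needs \<open>n\<close> large compared with \<open>1 / \<epsilon>\<close>. If \<open>n\<close> is at most the depth, the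
  recursion runs out of vertices before it is truncated (\<open>cav_saturated\<close>); then \<open>\<tau> = 0\<close> is used and the
  output is almost surely optimal.

  A depth-first evaluation of the recursion at one vertex takes at most \<open>4 * 8 ^ d\<close> transitions, so that
  all vertices together take time \<open>n * 2 ^ O(\<epsilon>\<^sup>-\<^sup>2)\<close>. The machine has no procedures, hence the program
  keeps the call stack in its memory and executes one transition of the evaluation per pass of
  a loop (\<open>cav_passes\<close>).
\<close>

section \<open>Truncated cavity recursion\<close>

text \<open>
  The list \<open>us\<close> holds the vertices still to be deleted and \<open>X\<close> those already deleted; for
  \<open>X = {v}\<close> and \<open>us = adj v\<close> this is the depth-\<open>d\<close> truncation of the cost of deleting the neighbours
  of \<open>v\<close>. Processing the siblings as a list makes both recursive calls start from the same
  enlarged set \<open>X\<close>, so that an evaluation marks a vertex once and unmarks it once.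
\<close>

fun cav :: "('a \<Rightarrow> 'a list) \<Rightarrow> ('a \<Rightarrow> real) \<Rightarrow> nat \<Rightarrow> 'a set \<Rightarrow> 'a list \<Rightarrow> real" where
  "cav adj x 0 X us = 0"
| "cav adj x (Suc d) X [] = 0"
| "cav adj x (Suc d) X (u # us) =
    (if u \<in> X then cav adj x (Suc d) X us
     else max 0 (x u - cav adj x d (insert u X) (adj u)) + cav adj x (Suc d) (insert u X) us)"

text \<open>
  The induction rule of the function package generalises over \<open>adj\<close> and \<open>x\<close>; here they stay fixed,
  so that assumptions on the graph remain usable in the induction steps.
\<close>

lemma cav_induct [case_names zero nil cons]:
  assumes "\<And>X us. P 0 X us"
    and "\<And>d X. P (Suc d) X []"
    and "\<And>d X u us. (u \<in> X \<Longrightarrow> P (Suc d) X us) \<Longrightarrow> (u \<notin> X \<Longrightarrow> P d (insert u X) (adj u)) \<Longrightarrow>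
      (u \<notin> X \<Longrightarrow> P (Suc d) (insert u X) us) \<Longrightarrow> P (Suc d) X (u # us)"
  shows "P d X us"
proof -
  have "a = adj \<Longrightarrow> P d X us" for a and x :: "'a \<Rightarrow> real"
    by (induction a x d X us rule: cav.induct) (use assms in blast)+
  then show ?thesis by blast
qed

lemma cav_nonneg: "0 \<le> cav adj x d X us"
  by (induction adj x d X us rule: cav.induct) auto

text \<open>
  Locality: a call sees only the weights of vertices outside \<open>X\<close>. This is what makes the weight of a
  vertex independent of the truncations that it is compared with.
\<close>

lemma cav_cong:
  "(\<And>v. v \<notin> X \<Longrightarrow> x v = y v) \<Longrightarrow> cav adj x d X us = cav adj y d X us"
  by (induction adj x d X us rule: cav.induct) auto

section \<open>Optima and alternating bounds\<close>

locale adj_graph =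
  fixes V :: "'a set" and adj :: "'a \<Rightarrow> 'a list"
  assumes finite_V: "finite V"
    and adj_subset: "v \<in> V \<Longrightarrow> set (adj v) \<subseteq> V"
    and adj_sym: "u \<in> V \<Longrightarrow> v \<in> set (adj u) \<Longrightarrow> u \<in> set (adj v)"
    and adj_irrefl: "v \<in> V \<Longrightarrow> v \<notin> set (adj v)"
    and deg_le_3: "v \<in> V \<Longrightarrow> length (adj v) \<le> 3"
begin

definition indep :: "'a set \<Rightarrow> bool" where
  "indep I \<longleftrightarrow> I \<subseteq> V \<and> (\<forall>u\<in>I. \<forall>v\<in>I. v \<notin> set (adj u))"

definition opt :: "('a \<Rightarrow> real) \<Rightarrow> 'a set \<Rightarrow> real" where
  "opt x R = Max (sum x ` {I. indep I \<and> I \<subseteq> R})"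

lemma indep_empty: "indep {}"
  by (simp add: indep_def)

lemma indep_subset: "indep I \<Longrightarrow> J \<subseteq> I \<Longrightarrow> indep J"
  unfolding indep_def by blast

lemma indep_insert:
  assumes "indep I" "v \<in> V" "I \<inter> set (adj v) = {}"
  shows "indep (insert v I)"
  using assms adj_sym adj_irrefl unfolding indep_def by blast

lemma finite_indep: "indep I \<Longrightarrow> finite I"
  using finite_V finite_subset unfolding indep_def by blast

lemma finite_indep_sets: "finite {I. indep I \<and> I \<subseteq> R}"
  by (rule finite_subset[of _ "Pow V"]) (auto simp: indep_def finite_V)

lemma opt_ge: "indep I \<Longrightarrow> I \<subseteq> R \<Longrightarrow> sum x I \<le> opt x R"
  unfolding opt_def using finite_indep_sets by (auto intro!: Max_ge)

lemma opt_attained: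
  obtains I where "indep I" "I \<subseteq> R" "sum x I = opt x R"
proof -
  have "opt x R \<in> sum x ` {I. indep I \<and> I \<subseteq> R}"
    unfolding opt_def using finite_indep_sets indep_empty by (intro Max_in) auto
  with that show ?thesis by auto
qed

lemma opt_mono: "R \<subseteq> R' \<Longrightarrow> opt x R \<le> opt x R'"
  by (metis opt_attained opt_ge order_trans)

lemma opt_branch:
  assumes "u \<in> R" "R \<subseteq> V"
  shows "opt x R = max (opt x (R - {u})) (x u + opt x (R - {u} - set (adj u)))"
proof (rule antisym)
  obtain I where I: "indep I" "I \<subseteq> R" "sum x I = opt x R" by (rule opt_attained)
  show "opt x R \<le> max (opt x (R - {u})) (x u + opt x (R - {u} - set (adj u)))"
  proof (cases "u \<in> I")
    case True
    have "sum x (I - {u}) \<le> opt x (R - {u} - set (adj u))"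
      using I True by (intro opt_ge indep_subset[OF I(1)]) (auto simp: indep_def)
    moreover have "sum x I = x u + sum x (I - {u})"
      using True finite_indep[OF I(1)] by (simp add: sum.remove)
    ultimately show ?thesis using I(3) by simp
  next
    case False
    then have "sum x I \<le> opt x (R - {u})"
      using I by (intro opt_ge) auto
    then show ?thesis using I(3) by simp
  qed
next
  obtain I where I: "indep I" "I \<subseteq> R - {u} - set (adj u)"
    "sum x I = opt x (R - {u} - set (adj u))" by (rule opt_attained)
  have "indep (insert u I)" using I assms by (intro indep_insert) auto
  then have "sum x (insert u I) \<le> opt x R" using I assms by (intro opt_ge) auto
  moreover have "sum x (insert u I) = x u + sum x I"
    using I finite_indep[OF I(1)] by (subst sum.insert) auto
  ultimately show "max (opt x (R - {u})) (x u + opt x (R - {u} - set (adj u))) \<le> opt x R"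
    using I(3) opt_mono[of "R - {u}" R x] by auto
qed

text \<open>
  Each level of the recursion subtracts the one below, so it turns upper bounds into lower bounds. At depth 0
  the value 0 is a lower bound because deleting vertices cannot increase the optimum.
\<close>

lemma cav_sandwich:
  assumes "set us \<subseteq> V"
  shows "(even d \<longrightarrow> cav adj x d X us \<le> opt x (V - X) - opt x (V - X - set us)) \<and>
         (odd d \<longrightarrow> opt x (V - X) - opt x (V - X - set us) \<le> cav adj x d X us)"
  using assms
proof (induction d X us rule: cav_induct[where adj = adj])
  case (zero X us)
  then show ?case using opt_mono[of "V - X - set us" "V - X" x] by auto
next
  case (nil d X)
  then show ?case by simp
next
  case (cons d X u us)
  show ?case
  proof (cases "u \<in> X")
    case True
    have "V - X - set (u # us) = V - X - set us" using True by auto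
    then show ?thesis using cons True by simp
  next
    case False
    have sets: "V - X - set (u # us) = V - insert u X - set us" "V - X - {u} = V - insert u X"
      by auto
    have "opt x (V - X) = max (opt x (V - insert u X))
        (x u + opt x (V - insert u X - set (adj u)))"
      using opt_branch[of u "V - X" x] cons.prems False sets by auto
    then show ?thesis
      using cons.IH(2,3)[OF False] cons.prems adj_subset[of u] False sets(1) by auto
  qed
qed

text \<open>
  Every level deletes a vertex, so beyond the number of remaining vertices the truncation depth is
  never reached.
\<close>

lemma cav_saturated:
  assumes "set us \<subseteq> V" "card (V - X) \<le> d"
  shows "cav adj x d X us = cav adj x (Suc d) X us"
  using assms
proof (induction d X us rule: cav_induct[where adj = adj])
  case (zero X us)
  then have "V \<subseteq> X" using finite_V by auto
  then have "set us \<subseteq> X" using zero by auto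
  then show ?case by (induction us) auto
next
  case (nil d X)
  then show ?case by simp
next
  case (cons d X u us)
  show ?case
  proof (cases "u \<in> X")
    case True
    then show ?thesis using cons by simp
  next
    case False
    have "V - insert u X = V - X - {u}" by auto
    then have "card (V - insert u X) \<le> d"
      using cons.prems False finite_V by simp
    then show ?thesis
      using cons.IH(2,3)[OF False] cons.prems adj_subset[of u] False by auto
  qed
qed

section \<open>Vertices selected by truncated cavity values\<close>

definition chosen :: "('a \<Rightarrow> real) \<Rightarrow> nat \<Rightarrow> 'a set" where
  "chosen x d = {v \<in> V. cav adj x d {v} (adj v) < x v}"

definition cavity :: "('a \<Rightarrow> real) \<Rightarrow> 'a \<Rightarrow> real" where
  "cavity x v = opt x (V - {v}) - opt x (V - {v} - set (adj v))"

lemma cav_bounds_cavity: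
  assumes "v \<in> V" "even d"
  shows "cav adj x d {v} (adj v) \<le> cavity x v" "cavity x v \<le> cav adj x (Suc d) {v} (adj v)"
  using cav_sandwich[of "adj v" d x "{v}"] cav_sandwich[of "adj v" "Suc d" x "{v}"]
    adj_subset[OF assms(1)] assms(2) unfolding cavity_def by auto

text \<open>
  Both facts compare the two branches of \<open>opt_branch\<close> at \<open>v\<close>: leaving \<open>v\<close> out is optimal if
  and only if \<open>x v \<le> cavity x v\<close>, and taking it is optimal if and only if the reverse inequality holds.
\<close>

lemma optimum_vs_cavity:
  assumes "indep I" "sum x I = opt x V" "v \<in> V"
  shows "v \<in> I \<Longrightarrow> cavity x v \<le> x v" and "cavity x v < x v \<Longrightarrow> v \<in> I"
proof -
  have branch: "opt x V = max (opt x (V - {v})) (x v + opt x (V - {v} - set (adj v)))"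
    using opt_branch[of v V x] assms(3) by simp
  show "cavity x v \<le> x v" if "v \<in> I"
  proof -
    have "sum x (I - {v}) \<le> opt x (V - {v} - set (adj v))"
      using assms that by (intro opt_ge indep_subset[OF assms(1)]) (auto simp: indep_def)
    moreover have "sum x I = x v + sum x (I - {v})"
      using that finite_indep[OF assms(1)] by (simp add: sum.remove)
    ultimately show ?thesis using branch assms(2) unfolding cavity_def by linarith
  qed
  show "v \<in> I" if "cavity x v < x v"
  proof (rule ccontr)
    assume "v \<notin> I"
    then have "sum x I \<le> opt x (V - {v})"
      using assms by (intro opt_ge) (auto simp: indep_def)
    then show False using branch assms(2) that unfolding cavity_def by linarith
  qed
qed

lemma chosen_subset_optimum:
  assumes "indep I" "sum x I = opt x V" "even d"
  shows "chosen x (Suc d) \<subseteq> I"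
proof
  fix v assume "v \<in> chosen x (Suc d)"
  then have v: "v \<in> V" "cav adj x (Suc d) {v} (adj v) < x v" by (auto simp: chosen_def)
  then have "cavity x v < x v"
    using cav_bounds_cavity(2)[OF v(1) assms(3), of x] by linarith
  then show "v \<in> I" using optimum_vs_cavity(2)[OF assms(1,2) v(1)] by blast
qed

lemma indep_chosen: "even d \<Longrightarrow> indep (chosen x (Suc d))"
  by (metis chosen_subset_optimum indep_subset opt_attained)

text \<open>
  For even \<open>d\<close> the true cavity value lies between the two truncations, so only for these vertices can
  the comparison with it be in doubt.
\<close>

definition undecided :: "('a \<Rightarrow> real) \<Rightarrow> nat \<Rightarrow> 'a \<Rightarrow> bool" where
  "undecided x d v \<longleftrightarrow>
     cav adj x d {v} (adj v) \<le> x v \<and> x v \<le> cav adj x (Suc d) {v} (adj v)"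

text \<open>
  A vertex of an optimal set that is not selected has a weight at least the cavity value, hence at
  least the lower truncation, and at most the upper one. All selected vertices belong to the
  optimal set, so nothing else is lost.
\<close>

lemma chosen_loss:
  assumes "even d"
  shows "opt x V - sum x (chosen x (Suc d)) \<le> (\<Sum>v\<in>V. x v * of_bool (undecided x d v))"
proof -
  obtain I where I: "indep I" "I \<subseteq> V" "sum x I = opt x V" by (rule opt_attained)
  let ?C = "chosen x (Suc d)"
  have C: "?C \<subseteq> I" using chosen_subset_optimum[OF I(1,3) assms] .
  have "opt x V - sum x ?C = sum x (I - ?C)"
    using C I finite_indep[OF I(1)] by (simp add: sum_diff)
  also have "\<dots> = (\<Sum>v\<in>I - ?C. x v * of_bool (undecided x d v))"
  proof (rule sum.cong[OF refl])
    fix v assume v: "v \<in> I - ?C"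
    then have "v \<in> V" using I by auto
    then have "undecided x d v"
      using v optimum_vs_cavity(1)[OF I(1,3), of v] cav_bounds_cavity(1)[of v d x] assms
      unfolding undecided_def chosen_def by auto
    then show "x v = x v * of_bool (undecided x d v)" by simp
  qed
  also have "\<dots> \<le> (\<Sum>v\<in>V. x v * of_bool (undecided x d v))"
    using I finite_V order_trans[OF cav_nonneg]
    by (intro sum_mono2) (auto simp: undecided_def of_bool_def)
  finally show ?thesis .
qed

lemma shifted_chosen_loss:
  assumes "even d" "0 \<le> \<tau>" and x_def: "x = (\<lambda>v. w v - \<tau>)"
  shows "opt w V - sum w (chosen x (Suc d))
    \<le> \<tau> * card V + (\<Sum>v\<in>V. w v * of_bool (undecided x d v))"
proof -
  let ?C = "chosen x (Suc d)"
  obtain I where I: "indep I" "I \<subseteq> V" "sum w I = opt w V" by (rule opt_attained)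
  have shift: "sum x J = sum w J - \<tau> * card J" if "J \<subseteq> V" for J
    using that by (simp add: x_def sum_subtractf)
  have "sum w I \<le> opt x V + \<tau> * card V"
  proof -
    have "\<tau> * card I \<le> \<tau> * card V"
      using assms(2) I finite_V by (intro mult_left_mono) (auto intro: card_mono)
    then show ?thesis using shift[OF I(2)] opt_ge[OF I(1,2), of x] by linarith
  qed
  moreover have "sum x ?C \<le> sum w ?C"
    using assms(2) by (intro sum_mono) (auto simp: x_def)
  moreover have "(\<Sum>v\<in>V. x v * of_bool (undecided x d v)) \<le> (\<Sum>v\<in>V. w v * of_bool (undecided x d v))"
    using assms(2) by (intro sum_mono mult_right_mono) (auto simp: x_def)
  ultimately show ?thesis using chosen_loss[OF assms(1), of x] I(3) by linarith
qed

text \<open>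
  Repeatedly taking a heaviest vertex discards, with it, at most three neighbours that are no heavier.
\<close>

lemma greedy_quarter:
  fixes w :: "'a \<Rightarrow> real"
  assumes "S \<subseteq> V" "\<And>v. v \<in> S \<Longrightarrow> 0 \<le> w v"
  obtains I where "indep I" "I \<subseteq> S" "sum w S \<le> 4 * sum w I"
  using assms
proof (induction "card S" arbitrary: S thesis rule: less_induct)
  case less
  show ?case
  proof (cases "S = {}")
    case True
    then show ?thesis using less.prems(1)[of "{}"] indep_empty by simp
  next
    case False
    have finS: "finite S" using less.prems(2) finite_V finite_subset by blast
    obtain v where v: "v \<in> S" "\<And>u. u \<in> S \<Longrightarrow> w u \<le> w v"
    proof -
      have "Max (w ` S) \<in> w ` S" using finS False by (intro Max_in) auto
      then obtain v where "v \<in> S" "w v = Max (w ` S)" by auto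
      then show ?thesis using that[of v] finS by auto
    qed
    let ?N = "insert v (set (adj v) \<inter> S)"
    let ?S = "S - ?N"
    have "card ?S < card S" using finS v(1) by (intro psubset_card_mono) auto
    then obtain I where I: "indep I" "I \<subseteq> ?S" "sum w ?S \<le> 4 * sum w I"
      using less.hyps[of ?S] less.prems(2,3) by (metis Diff_iff Diff_subset subset_trans)
    have vV: "v \<in> V" using v less.prems by auto
    have "card ?N \<le> Suc (card (set (adj v)))"
      by (rule order_trans[OF card_insert_le_m1[of "Suc (card (set (adj v)))"]])
        (auto intro: card_mono)
    also have "\<dots> \<le> 4" using deg_le_3[OF vV] card_length[of "adj v"] by linarith
    finally have "card ?N \<le> 4" .
    have "sum w ?N \<le> of_nat (card ?N) * w v" using v by (intro sum_bounded_above) auto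
    also have "\<dots> \<le> 4 * w v"
      using \<open>card ?N \<le> 4\<close> v(1) less.prems(3) by (intro mult_right_mono) auto
    finally have "sum w ?N \<le> 4 * w v" .
    moreover have "sum w S = sum w ?S + sum w ?N"
      using finS v(1) by (intro sum.subset_diff) auto
    moreover have "sum w (insert v I) = w v + sum w I"
      using I finite_indep[OF I(1)] by (subst sum.insert) auto
    ultimately have "sum w S \<le> 4 * sum w (insert v I)" using I(3) by linarith
    moreover have "indep (insert v I)" using I vV by (intro indep_insert) auto
    ultimately show ?thesis using less.prems(1)[of "insert v I"] I v(1) by auto
  qed
qed

lemma opt_ge_quarter:
  assumes "\<And>v. v \<in> V \<Longrightarrow> 0 \<le> w v"
  shows "sum w V \<le> 4 * opt w V"
  by (rule greedy_quarter[of V w]) (use assms opt_ge[of _ V w] in force)+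

end

section \<open>Exponential weights\<close>

abbreviation expo :: "real measure" where
  "expo \<equiv> exponential_law 1"

lemma prob_space_expo: "prob_space expo"
  unfolding exponential_law_def by (rule prob_space_exponential_density) simp

lemma sets_expo [measurable_cong, simp]: "sets expo = sets borel"
  by (simp add: exponential_law_def)

lemma space_expo [simp]: "space expo = UNIV"
  by (simp add: exponential_law_def)

lemma nn_integral_expo:
  assumes "f \<in> borel_measurable borel"
  shows "(\<integral>\<^sup>+y. f y \<partial>expo) = (\<integral>\<^sup>+y. ennreal (exp (- y)) * indicator {0..} y * f y \<partial>lborel)"
proof -
  have "(\<integral>\<^sup>+y. f y \<partial>expo) = (\<integral>\<^sup>+y. ennreal (exponential_density 1 y) * f y \<partial>lborel)"
    unfolding exponential_law_def using assms by (intro nn_integral_density) auto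
  also have "\<dots> = (\<integral>\<^sup>+y. ennreal (exp (- y)) * indicator {0..} y * f y \<partial>lborel)"
    by (intro nn_integral_cong) (auto simp: exponential_density_def split: split_indicator)
  finally show ?thesis .
qed

lemma AE_expo_nonneg: "AE y in expo. 0 \<le> y"
  unfolding exponential_law_def
  by (subst AE_density) (auto simp: exponential_density_def intro!: AE_I2)

lemma tendsto_exp_neg: "0 < k \<Longrightarrow> ((\<lambda>x::real. c * exp (- (k * x))) \<longlongrightarrow> 0) at_top"
  by real_asymp

lemma emeasure_expo_interval:
  assumes "0 \<le> c" "0 \<le> c'"
  shows "emeasure expo {c..c'} \<le> ennreal \<bar>exp (- c) - exp (- c')\<bar>"
proof (cases "c \<le> c'")
  case True
  have "emeasure expo {c..c'} = (\<integral>\<^sup>+y. indicator {c..c'} y \<partial>expo)"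
    by simp
  also have "\<dots> = (\<integral>\<^sup>+y. ennreal (exp (- y)) * indicator {c..c'} y \<partial>lborel)"
    using assms by (subst nn_integral_expo) (auto intro!: nn_integral_cong split: split_indicator)
  also have "\<dots> = ennreal (- exp (- c') - (- exp (- c)))"
    using True by (intro nn_integral_FTC_Icc) (auto intro!: derivative_eq_intros)
  finally show ?thesis by simp
qed simp

text \<open>
  On \<open>[c, c']\<close> only the second exponential is below 1, and beyond \<open>c'\<close> the difference is a multiple of
  \<open>exp (- y)\<close>; multiplied by the density, both pieces have elementary antiderivatives.
\<close>

lemma contraction_ordered:
  assumes "0 \<le> c" "c \<le> c'"
  shows "(\<integral>\<^sup>+y. ennreal (exp (- max 0 (y - c')) - exp (- max 0 (y - c))) \<partial>expo)
    = ennreal ((exp (- c) - exp (- c')) / 2)"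
proof -
  let ?f = "\<lambda>y. exp (- y) - exp (c - 2 * y)" and ?g = "\<lambda>y. (exp c' - exp c) * exp (- (2 * y))"
  have "(\<integral>\<^sup>+y. ennreal (exp (- max 0 (y - c')) - exp (- max 0 (y - c))) \<partial>expo)
     = (\<integral>\<^sup>+y. ennreal (exp (- y)) * indicator {0..} y *
          ennreal (exp (- max 0 (y - c')) - exp (- max 0 (y - c))) \<partial>lborel)"
    by (rule nn_integral_expo) auto
  also have "\<dots> = (\<integral>\<^sup>+y. ennreal (?f y) * indicator {c..c'} y + ennreal (?g y) * indicator {c'..} y \<partial>lborel)"
  proof (rule nn_integral_cong_AE)
    have "y \<noteq> c' \<longrightarrow> ennreal (exp (- y)) * indicator {0..} y * ennreal (exp (- max 0 (y - c')) - exp (- max 0 (y - c)))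
        = ennreal (?f y) * indicator {c..c'} y + ennreal (?g y) * indicator {c'..} y" for y
      using assms by (auto simp: max_def ennreal_mult'[symmetric] algebra_simps
          exp_add[symmetric] exp_diff[symmetric] split: split_indicator)
    then show "AE y in lborel. ennreal (exp (- y)) * indicator {0..} y *
          ennreal (exp (- max 0 (y - c')) - exp (- max 0 (y - c)))
        = ennreal (?f y) * indicator {c..c'} y + ennreal (?g y) * indicator {c'..} y"
      using AE_lborel_singleton[of c'] by (auto elim!: eventually_mono)
  qed
  also have "\<dots> = (\<integral>\<^sup>+y. ennreal (?f y) * indicator {c..c'} y \<partial>lborel) + (\<integral>\<^sup>+y. ennreal (?g y) * indicator {c'..} y \<partial>lborel)"
    by (intro nn_integral_add) auto
  also have "(\<integral>\<^sup>+y. ennreal (?f y) * indicator {c..c'} y \<partial>lborel)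
      = ennreal ((- exp (- c') + exp (c - 2 * c') / 2) - (- exp (- c) + exp (c - 2 * c) / 2))"
    using assms by (intro nn_integral_FTC_Icc) (auto intro!: derivative_eq_intros)
  also have "(\<integral>\<^sup>+y. ennreal (?g y) * indicator {c'..} y \<partial>lborel)
      = ennreal (0 - ((- (exp c' - exp c) / 2) * exp (- (2 * c'))))"
    using assms
    by (intro nn_integral_FTC_atLeast[where F = "\<lambda>y. (- (exp c' - exp c) / 2) * exp (- (2 * y))"]
        tendsto_exp_neg) (auto intro!: derivative_eq_intros simp: field_simps)
  also have "ennreal ((- exp (- c') + exp (c - 2 * c') / 2) - (- exp (- c) + exp (c - 2 * c) / 2))
      + ennreal (0 - ((- (exp c' - exp c) / 2) * exp (- (2 * c'))))
    = ennreal (((- exp (- c') + exp (c - 2 * c') / 2) - (- exp (- c) + exp (c - 2 * c) / 2))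
      + (0 - ((- (exp c' - exp c) / 2) * exp (- (2 * c')))))"
  proof (rule ennreal_plus[symmetric])
    let ?F = "\<lambda>y. - exp (- y) + exp (c - 2 * y) / 2"
    have "?F c \<le> ?F c'"
    proof (rule DERIV_nonneg_imp_nondecreasing[OF assms(2)])
      fix y assume "c \<le> y" "y \<le> c'"
      then have "DERIV ?F y :> ?f y" "0 \<le> ?f y" by (auto intro!: derivative_eq_intros)
      then show "\<exists>D. DERIV ?F y :> D \<and> 0 \<le> D" by blast
    qed
    then show "0 \<le> (- exp (- c') + exp (c - 2 * c') / 2) - (- exp (- c) + exp (c - 2 * c) / 2)"
      by simp
    show "0 \<le> 0 - ((- (exp c' - exp c) / 2) * exp (- (2 * c')))"
      using assms by (simp add: mult_nonpos_nonneg)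
  qed
  also have "((- exp (- c') + exp (c - 2 * c') / 2) - (- exp (- c) + exp (c - 2 * c) / 2))
      + (0 - ((- (exp c' - exp c) / 2) * exp (- (2 * c')))) = (exp (- c) - exp (- c')) / 2"
    by (simp add: algebra_simps exp_add[symmetric] exp_diff[symmetric] add_divide_distrib diff_divide_distrib)
  finally show ?thesis .
qed

text \<open>
  The heart of the correlation decay: after the map \<open>t \<mapsto> exp (- t)\<close>, one step of the cavity recursion
  contracts by the factor one half, averaged over the weight of the vertex. Equality holds because the integrand
  has a constant sign, so that its mean is a difference of the means \<open>1 - exp (- c) / 2\<close>.
\<close>

lemma contraction:
  assumes "0 \<le> c" "0 \<le> c'"
  shows "(\<integral>\<^sup>+y. ennreal \<bar>exp (- max 0 (y - c)) - exp (- max 0 (y - c'))\<bar> \<partial>expo)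
    = ennreal (\<bar>exp (- c) - exp (- c')\<bar> / 2)"
proof -
  have *: "(\<integral>\<^sup>+y. ennreal \<bar>exp (- max 0 (y - c)) - exp (- max 0 (y - c'))\<bar> \<partial>expo)
    = ennreal (\<bar>exp (- c) - exp (- c')\<bar> / 2)" if "0 \<le> c" "c \<le> c'" for c c' :: real
  proof -
    have "\<bar>exp (- max 0 (y - c)) - exp (- max 0 (y - c'))\<bar>
        = exp (- max 0 (y - c')) - exp (- max 0 (y - c))" for y
    proof -
      have "exp (- max 0 (y - c)) \<le> exp (- max 0 (y - c'))" using that by simp
      then show ?thesis by simp
    qed
    moreover have "\<bar>exp (- c) - exp (- c')\<bar> = exp (- c) - exp (- c')" using that by simp
    ultimately show ?thesis using contraction_ordered[OF that] by simp
  qed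
  show ?thesis
    using *[of c c'] *[of c' c] assms by (cases "c \<le> c'") (auto simp: abs_minus_commute)
qed

lemma second_moment_expo: "(\<integral>\<^sup>+y. ennreal (y\<^sup>2) \<partial>expo) = 2"
proof -
  have "(\<integral>\<^sup>+y. ennreal (y\<^sup>2) \<partial>expo) = (\<integral>\<^sup>+y. ennreal (exponential_density 1 y) * ennreal (y\<^sup>2) \<partial>lborel)"
    unfolding exponential_law_def by (intro nn_integral_density) auto
  also have "\<dots> = (\<integral>\<^sup>+y. ennreal (exponential_density 1 y * y ^ 2) \<partial>lborel)"
    by (intro nn_integral_cong) (simp add: ennreal_mult' exponential_density_nonneg)
  also have "\<dots> = 2"
    by (subst nn_integral_erlang_ith_moment) (auto simp: fact_numeral)
  finally show ?thesis .
qed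

lemma laplace_expo: "(\<integral>\<^sup>+y. ennreal (exp (- y)) \<partial>expo) = ennreal (1 / 2)"
proof -
  have "(\<integral>\<^sup>+y. ennreal (exp (- y)) \<partial>expo)
      = (\<integral>\<^sup>+y. ennreal (exp (- (2 * y))) * indicator {0..} y \<partial>lborel)"
    by (subst nn_integral_expo)
      (auto intro!: nn_integral_cong simp: ennreal_mult'[symmetric] exp_add[symmetric] split: split_indicator)
  also have "\<dots> = ennreal (0 - (- 1 / 2) * exp (- (2 * 0)))"
    by (intro nn_integral_FTC_atLeast tendsto_exp_neg) (auto intro!: derivative_eq_intros)
  finally show ?thesis by simp
qed

abbreviation expos :: "nat \<Rightarrow> (nat \<Rightarrow> real) measure" where
  "expos n \<equiv> \<Pi>\<^sub>M i\<in>{..<n}. expo"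

interpretation expos: product_sigma_finite "\<lambda>_::nat. expo"
  by (simp add: product_sigma_finite_def prob_space_expo prob_space_imp_sigma_finite)

lemma prob_space_expos: "prob_space (expos n)"
  by (rule prob_space_PiM) (rule prob_space_expo)

lemma AE_expos_nonneg: "AE w in expos n. \<forall>i<n. 0 \<le> w i"
proof -
  have "AE w in expos n. 0 \<le> w i" if "i \<in> {..<n}" for i
    by (rule AE_PiM_component[OF _ that AE_expo_nonneg]) (rule prob_space_expo)
  then have "AE w in expos n. \<forall>i\<in>{..<n}. 0 \<le> w i"
    by (subst AE_finite_all) auto
  then show ?thesis by (auto elim!: eventually_mono)
qed

text \<open>
  Redrawing one coordinate independently does not change the law. The inner integral then averages over
  the weight of \<open>u\<close> alone, while functions that ignore this coordinate act as constants.
\<close>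

lemma resample:
  assumes u: "u < n" and f [measurable]: "f \<in> borel_measurable (expos n)"
  shows "(\<integral>\<^sup>+w. f w \<partial>expos n) = (\<integral>\<^sup>+w. (\<integral>\<^sup>+y. f (w(u := y)) \<partial>expo) \<partial>expos n)"
proof -
  let ?I = "{..<n} - {u}"
  have I: "insert u ?I = {..<n}" using u by auto
  have f': "f \<in> borel_measurable (Pi\<^sub>M (insert u ?I) (\<lambda>_. expo))" using f I by simp
  have upd: "(\<lambda>(w, y). w(u := y)) \<in> measurable (expos n \<Otimes>\<^sub>M expo) (expos n)"
    using measurable_add_dim[of u "{..<n}" "\<lambda>_. expo"] u by (simp add: insert_absorb)
  interpret E: prob_space expo by (rule prob_space_expo)
  let ?g = "\<lambda>w. \<integral>\<^sup>+y. f (w(u := y)) \<partial>expo"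
  have "(\<lambda>(w, y). f (w(u := y))) \<in> borel_measurable (expos n \<Otimes>\<^sub>M expo)"
    using measurable_compose[OF upd f] by (simp add: case_prod_beta)
  then have "?g \<in> borel_measurable (expos n)"
    by measurable
  then have g': "?g \<in> borel_measurable (Pi\<^sub>M (insert u ?I) (\<lambda>_. expo))" using I by simp
  have "(\<integral>\<^sup>+w. f w \<partial>expos n) = (\<integral>\<^sup>+w. ?g w \<partial>Pi\<^sub>M ?I (\<lambda>_. expo))"
    using expos.product_nn_integral_insert[OF _ _ f'] I by simp
  \<comment> \<open>The inner integral no longer depends on coordinate \<open>u\<close>, so a further integration over it changes nothing.\<close>
  also have "\<dots> = (\<integral>\<^sup>+w. (\<integral>\<^sup>+z. ?g (w(u := z)) \<partial>expo) \<partial>Pi\<^sub>M ?I (\<lambda>_. expo))"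
    using E.emeasure_space_1 by simp
  also have "\<dots> = (\<integral>\<^sup>+w. ?g w \<partial>expos n)"
    using expos.product_nn_integral_insert[OF _ _ g'] I by simp
  finally show ?thesis .
qed

text \<open>
  Exponential Markov inequality: \<open>exp (- W)\<close> has mean \<open>1 / 2\<close>, so the probability is at most
  \<open>(exp (1 / 2) / 2) ^ n\<close>, and \<open>exp 1 \<le> 3 < (7 / 4)\<^sup>2\<close>.
\<close>

lemma lower_tail_sum:
  "emeasure (expos n) {w \<in> space (expos n). (\<Sum>i<n. w i) < real n / 2} \<le> ennreal ((7 / 8) ^ n)"
proof -
  let ?u = "\<lambda>w. \<Prod>i<n. ennreal (exp (- w i))"
  have u_eq: "?u w = ennreal (exp (- (\<Sum>i<n. w i)))" for w :: "nat \<Rightarrow> real"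
    by (simp add: prod_ennreal exp_sum sum_negf[symmetric])
  have meas: "?u \<in> borel_measurable (expos n)" by measurable
  have "emeasure (expos n) {w \<in> space (expos n). (\<Sum>i<n. w i) < real n / 2}
      \<le> emeasure (expos n) {w \<in> space (expos n). 1 \<le> ennreal (exp (n / 2)) * ?u w}"
  proof (rule emeasure_mono)
    show "{w \<in> space (expos n). (\<Sum>i<n. w i) < real n / 2}
        \<subseteq> {w \<in> space (expos n). 1 \<le> ennreal (exp (n / 2)) * ?u w}"
      by (auto simp: u_eq ennreal_mult'[symmetric] exp_add[symmetric])
  qed measurable
  also have "\<dots> \<le> ennreal (exp (n / 2)) * (\<integral>\<^sup>+w. ?u w * indicator (space (expos n)) w \<partial>expos n)"
    using nn_integral_Markov_inequality[of ?u "space (expos n)" "expos n" "ennreal (exp (n / 2))"]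
    by simp
  also have "(\<integral>\<^sup>+w. ?u w * indicator (space (expos n)) w \<partial>expos n) = (\<integral>\<^sup>+w. ?u w \<partial>expos n)"
    by (intro nn_integral_cong) auto
  also have "\<dots> = (\<Prod>i<n. \<integral>\<^sup>+y. ennreal (exp (- y)) \<partial>expo)"
    by (intro expos.product_nn_integral_prod) auto
  also have "\<dots> = ennreal ((1 / 2) ^ n)"
    unfolding laplace_expo by (simp only: prod_constant card_lessThan, rule ennreal_power) simp
  also have "ennreal (exp (n / 2)) * ennreal ((1 / 2) ^ n) = ennreal ((exp (1 / 2) / 2) ^ n)"
    by (simp add: ennreal_mult'[symmetric] power_divide exp_of_nat_mult[symmetric])
  also have "\<dots> \<le> ennreal ((7 / 8) ^ n)"
  proof (intro ennreal_leI power_mono)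
    have "(exp (1 / 2 :: real))\<^sup>2 \<le> (7 / 4)\<^sup>2"
      using exp_le by (simp add: power2_eq_square exp_add[symmetric])
    then have "exp (1 / 2 :: real) \<le> 7 / 4" by (rule power2_le_imp_le) simp
    then show "exp (1 / 2 :: real) / 2 \<le> 7 / 8" by simp
  qed simp
  finally show ?thesis .
qed

section \<open>Elementary inequalities\<close>

lemma abs_exp_add_diff:
  fixes a b a' b' :: real
  assumes "0 \<le> a'" "0 \<le> b"
  shows "\<bar>exp (- (a + b)) - exp (- (a' + b'))\<bar> \<le> \<bar>exp (- a) - exp (- a')\<bar> + \<bar>exp (- b) - exp (- b')\<bar>"
proof -
  have "exp (- (a + b)) - exp (- (a' + b'))
      = exp (- b) * (exp (- a) - exp (- a')) + exp (- a') * (exp (- b) - exp (- b'))"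
    by (simp add: algebra_simps exp_add[symmetric])
  then have "\<bar>exp (- (a + b)) - exp (- (a' + b'))\<bar>
      \<le> exp (- b) * \<bar>exp (- a) - exp (- a')\<bar> + exp (- a') * \<bar>exp (- b) - exp (- b')\<bar>"
    by (metis abs_exp_cancel abs_mult abs_triangle_ineq)
  also have "\<dots> \<le> 1 * \<bar>exp (- a) - exp (- a')\<bar> + 1 * \<bar>exp (- b) - exp (- b')\<bar>"
    using assms by (intro add_mono mult_right_mono) auto
  finally show ?thesis by simp
qed

text \<open>
  Completing the square. It bounds the expected weight on a rare event by a second moment and a
  probability, without regard to how the weight and the event depend on each other.
\<close>

lemma weighted_event_bound:
  fixes a b :: real
  assumes "0 < a"
  shows "b * of_bool P \<le> a * b\<^sup>2 + of_bool P / (4 * a)"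
proof (cases P)
  case True
  have "0 \<le> (2 * a * b - 1)\<^sup>2 / (4 * a)" using assms by simp
  also have "\<dots> = a * b\<^sup>2 - b + 1 / (4 * a)"
    using assms by (simp add: power2_eq_square field_simps)
  finally show ?thesis using True by simp
qed (use assms in simp)

text \<open>
  The constants: \<open>1500 / 32 \<ge> 44 = 4 * 11\<close>, and the fourth power of \<open>exp (11 / \<epsilon>) \<ge> 11 / \<epsilon>\<close> dominates
  \<open>14641 / \<epsilon> ^ 4\<close>.
\<close>

lemma exp_beats_quartic:
  fixes \<epsilon> :: real
  assumes "0 < \<epsilon>" "\<epsilon> \<le> 1" "1500 / \<epsilon>\<^sup>2 \<le> d"
  shows "exp (- (\<epsilon> / 32 * d)) \<le> \<epsilon> ^ 4 / 14641"
proof -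
  have "44 / \<epsilon> \<le> \<epsilon> / 32 * (1500 / \<epsilon>\<^sup>2)" using assms(1) by (simp add: field_simps power2_eq_square)
  also have "\<dots> \<le> \<epsilon> / 32 * d" using assms by (intro mult_left_mono) auto
  finally have "44 / \<epsilon> \<le> \<epsilon> / 32 * d" .
  have "(11 / \<epsilon>) ^ 4 \<le> exp (11 / \<epsilon>) ^ 4"
    using assms(1) exp_ge_add_one_self[of "11 / \<epsilon>"] by (intro power_mono) (linarith, simp)
  also have "\<dots> = exp (44 / \<epsilon>)" by (simp add: exp_of_nat_mult[symmetric])
  also have "\<dots> \<le> exp (\<epsilon> / 32 * d)" using \<open>44 / \<epsilon> \<le> \<epsilon> / 32 * d\<close> by simp
  finally have "inverse (exp (\<epsilon> / 32 * d)) \<le> inverse ((11 / \<epsilon>) ^ 4)"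
    using assms(1) by (intro le_imp_inverse_le) auto
  then show ?thesis by (simp add: exp_minus power_divide)
qed

lemma seven_eighths_power:
  fixes \<epsilon> :: real
  assumes "0 < \<epsilon>" "\<epsilon> \<le> 1" "1500 / \<epsilon>\<^sup>2 \<le> m"
  shows "(7 / 8) ^ m \<le> \<epsilon> / 2"
proof -
  have "14 / \<epsilon> \<le> 1500 / \<epsilon>\<^sup>2"
    using assms(1,2) by (simp add: field_simps power2_eq_square)
  then have m: "14 / \<epsilon> \<le> m" using assms(3) by linarith
  have "2 / \<epsilon> \<le> 1 + m * (1 / 7)" using m by simp
  also have "\<dots> \<le> (1 + 1 / 7) ^ m" by (rule Bernoulli_inequality) simp
  finally have "inverse ((8 / 7) ^ m) \<le> inverse (2 / \<epsilon>)"
    using assms(1) by (intro le_imp_inverse_le) auto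
  then show ?thesis by (simp add: power_divide)
qed

section \<open>Decay of correlations\<close>

locale input_graph = adj_graph "{..<n}" adj for n :: nat and adj :: "nat \<Rightarrow> nat list"

locale random_graph = input_graph +
  fixes \<tau> :: real
  assumes \<tau>_nonneg: "0 \<le> \<tau>"
begin

abbreviation pcav :: "nat \<Rightarrow> nat set \<Rightarrow> nat list \<Rightarrow> (nat \<Rightarrow> real) \<Rightarrow> real" where
  "pcav d X us w \<equiv> cav adj (\<lambda>v. w v - \<tau>) d X us"

lemma pcav_measurable:
  "set us \<subseteq> {..<n} \<Longrightarrow> pcav d X us \<in> borel_measurable (expos n)"
proof (induction d X us rule: cav_induct[where adj = adj])
  case (cons d X u us)
  then show ?case
  proof (cases "u \<in> X")
    case False
    have [measurable]: "pcav d (insert u X) (adj u) \<in> borel_measurable (expos n)"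
      "pcav (Suc d) (insert u X) us \<in> borel_measurable (expos n)"
      using cons False adj_subset[of u] by auto
    have [measurable]: "(\<lambda>w. w u) \<in> borel_measurable (expos n)"
      using cons.prems by (auto intro!: measurable_component_singleton)
    show ?thesis using False by simp
  qed simp
qed simp_all

definition gap :: "nat \<Rightarrow> nat set \<Rightarrow> nat list \<Rightarrow> ennreal" where
  "gap d X us = (\<integral>\<^sup>+w. ennreal \<bar>exp (- pcav d X us w) - exp (- pcav (Suc d) X us w)\<bar> \<partial>expos n)"

text \<open>
  By \<open>abs_exp_add_diff\<close> the gap is at most the sum of the gaps of the children; each child that is not yet
  deleted contributes half of its own gap times \<open>exp (- \<tau>)\<close>. A child \<open>u\<close> of \<open>v\<close> has the deleted
  neighbour \<open>v\<close>, so at most two children of its own, and the two halves add up to at most 1. The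
  \<open>v \<in> X\<close> assumption carries this fact through the induction.
\<close>

lemma gap_decay:
  assumes "v \<in> X" "v < n" "set us \<subseteq> set (adj v)"
  shows "gap d X us \<le> ennreal ((if d = 0 then 1 else card (set us - X) / 2) * exp (- (\<tau> * d)))"
  using assms
proof (induction d X us arbitrary: v rule: cav_induct[where adj = adj])
  case (zero X us)
  have "gap 0 X us \<le> (\<integral>\<^sup>+w. 1 \<partial>expos n)"
    unfolding gap_def
  proof (rule nn_integral_mono)
    fix w :: "nat \<Rightarrow> real"
    have "0 \<le> pcav (Suc 0) X us w" by (rule cav_nonneg)
    then show "ennreal \<bar>exp (- pcav 0 X us w) - exp (- pcav (Suc 0) X us w)\<bar> \<le> 1" by simp
  qed
  also have "\<dots> = 1" using prob_space.emeasure_space_1[OF prob_space_expos] by simp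
  finally show ?case by simp
next
  case (nil d X)
  then show ?case by (simp add: gap_def)
next
  case (cons d X u us)
  show ?case
  proof (cases "u \<in> X")
    case True
    then have "set (u # us) - X = set us - X" by auto
    then show ?thesis using cons.IH(1)[OF True cons.prems(1,2)] cons.prems True
      by (simp add: gap_def)
  next
    case False
    have u: "u < n" "v \<in> set (adj u)" using cons.prems adj_subset[of v] adj_sym[of v u] by auto
    have us: "set us \<subseteq> {..<n}" "set (adj u) \<subseteq> {..<n}"
      using cons.prems adj_subset[of v] adj_subset[of u] u by auto
    let ?A = "pcav d (insert u X) (adj u)" and ?A' = "pcav (Suc d) (insert u X) (adj u)"
    let ?T = "pcav (Suc d) (insert u X) us" and ?T' = "pcav (Suc (Suc d)) (insert u X) us"
    let ?h = "\<lambda>w. ennreal \<bar>exp (- max 0 (w u - (\<tau> + ?A w))) - exp (- max 0 (w u - (\<tau> + ?A' w)))\<bar>"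
    have [measurable]: "?A \<in> borel_measurable (expos n)" "?A' \<in> borel_measurable (expos n)"
      "?T \<in> borel_measurable (expos n)" "?T' \<in> borel_measurable (expos n)"
      using us by (auto intro!: pcav_measurable)
    have [measurable]: "(\<lambda>w. w u) \<in> borel_measurable (expos n)"
      using u by (auto intro!: measurable_component_singleton)
    have nonneg: "0 \<le> ?T w" "0 \<le> ?A w" "0 \<le> ?A' w" for w by (rule cav_nonneg)+
    have "gap (Suc d) X (u # us) \<le> (\<integral>\<^sup>+w. ?h w + ennreal \<bar>exp (- ?T w) - exp (- ?T' w)\<bar> \<partial>expos n)"
      unfolding gap_def
    proof (rule nn_integral_mono)
      fix w
      have "\<bar>exp (- pcav (Suc d) X (u # us) w) - exp (- pcav (Suc (Suc d)) X (u # us) w)\<bar>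
          \<le> \<bar>exp (- max 0 (w u - (\<tau> + ?A w))) - exp (- max 0 (w u - (\<tau> + ?A' w)))\<bar>
            + \<bar>exp (- ?T w) - exp (- ?T' w)\<bar>"
        using abs_exp_add_diff[of "max 0 (w u - (\<tau> + ?A' w))" "?T w" "max 0 (w u - (\<tau> + ?A w))" "?T' w"]
          False nonneg by (simp add: diff_diff_eq)
      then show "ennreal \<bar>exp (- pcav (Suc d) X (u # us) w) - exp (- pcav (Suc (Suc d)) X (u # us) w)\<bar>
          \<le> ?h w + ennreal \<bar>exp (- ?T w) - exp (- ?T' w)\<bar>"
        by (simp add: ennreal_plus[symmetric] ennreal_leI del: ennreal_plus)
    qed
    also have "\<dots> = (\<integral>\<^sup>+w. ?h w \<partial>expos n) + gap (Suc d) (insert u X) us"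
      unfolding gap_def by (rule nn_integral_add) auto
    also have "(\<integral>\<^sup>+w. ?h w \<partial>expos n) = (\<integral>\<^sup>+w. (\<integral>\<^sup>+y. ?h (w(u := y)) \<partial>expo) \<partial>expos n)"
      by (rule resample[OF u(1)]) measurable
    also have "\<dots> = (\<integral>\<^sup>+w. ennreal (exp (- \<tau>) / 2) * ennreal \<bar>exp (- ?A w) - exp (- ?A' w)\<bar> \<partial>expos n)"
    proof (rule nn_integral_cong)
      fix w :: "nat \<Rightarrow> real"
      have local: "?A (w(u := y)) = ?A w" "?A' (w(u := y)) = ?A' w" for y
        by (rule cav_cong; simp)+
      have "(\<integral>\<^sup>+y. ?h (w(u := y)) \<partial>expo)
          = ennreal (\<bar>exp (- (\<tau> + ?A w)) - exp (- (\<tau> + ?A' w))\<bar> / 2)"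
        unfolding local using contraction[of "\<tau> + ?A w" "\<tau> + ?A' w"] nonneg \<tau>_nonneg by simp
      also have "exp (- (\<tau> + ?A w)) - exp (- (\<tau> + ?A' w)) = exp (- \<tau>) * (exp (- ?A w) - exp (- ?A' w))"
        by (simp add: algebra_simps exp_add[symmetric] exp_diff)
      finally show "(\<integral>\<^sup>+y. ?h (w(u := y)) \<partial>expo)
          = ennreal (exp (- \<tau>) / 2) * ennreal \<bar>exp (- ?A w) - exp (- ?A' w)\<bar>"
        by (simp add: abs_mult ennreal_mult'[symmetric])
    qed
    also have "\<dots> = ennreal (exp (- \<tau>) / 2) * gap d (insert u X) (adj u)"
      unfolding gap_def by (rule nn_integral_cmult) measurable
    also have "gap d (insert u X) (adj u) \<le> ennreal (exp (- (\<tau> * d)))"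
    proof -
      have "set (adj u) - insert u X \<subseteq> set (adj u) - {v}" using cons.prems by auto
      then have "card (set (adj u) - insert u X) \<le> card (set (adj u) - {v})"
        by (intro card_mono) auto
      also have "\<dots> \<le> 2"
        using u deg_le_3[of u] card_length[of "adj u"] by (simp add: card_Diff_singleton)
      finally have "(if d = 0 then 1 else card (set (adj u) - insert u X) / 2) * exp (- (\<tau> * d))
          \<le> 1 * exp (- (\<tau> * d))"
        by (intro mult_right_mono) auto
      then show ?thesis
        using cons.IH(2)[OF False, of u] u by (auto intro: order_trans ennreal_leI)
    qed
    also have "gap (Suc d) (insert u X) us
        \<le> ennreal (card (set us - insert u X) / 2 * exp (- (\<tau> * Suc d)))"
      using cons.IH(3)[OF False, of v] cons.prems by simp
    also have "ennreal (exp (- \<tau>) / 2) * ennreal (exp (- (\<tau> * d)))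
          + ennreal (card (set us - insert u X) / 2 * exp (- (\<tau> * Suc d)))
        = ennreal (Suc (card (set us - insert u X)) / 2 * exp (- (\<tau> * Suc d)))"
      by (simp add: ennreal_mult'[symmetric] ennreal_plus[symmetric] algebra_simps exp_add[symmetric]
          add_divide_distrib del: ennreal_plus)
    also have "Suc (card (set us - insert u X)) = card (set (u # us) - X)"
    proof -
      have "set (u # us) - X = insert u (set us - insert u X)" using False by auto
      then show ?thesis by simp
    qed
    finally show ?thesis by (simp add: add_mono mult_left_mono)
  qed
qed

abbreviation pundecided :: "nat \<Rightarrow> nat \<Rightarrow> (nat \<Rightarrow> real) \<Rightarrow> bool" where
  "pundecided d v w \<equiv> undecided (\<lambda>v. w v - \<tau>) d v"

lemma pundecided_measurable:
  assumes "v < n"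
  shows "{w \<in> space (expos n). pundecided d v w} \<in> sets (expos n)"
proof -
  have [measurable]: "pcav e {v} (adj v) \<in> borel_measurable (expos n)" for e
    using adj_subset[of v] assms by (auto intro!: pcav_measurable)
  have [measurable]: "(\<lambda>w. w v) \<in> borel_measurable (expos n)"
    using assms by (auto intro!: measurable_component_singleton)
  show ?thesis
    unfolding undecided_def by (intro sets.sets_Collect_conj borel_measurable_le) measurable
qed

text \<open>
  The truncations at \<open>v\<close> ignore the weight of \<open>v\<close>, and an exponential weight falls into a fixed interval
  with a probability at most the difference of \<open>exp (- t)\<close> at its end points.
\<close>

lemma prob_undecided_le_gap:
  assumes "v < n"
  shows "emeasure (expos n) {w \<in> space (expos n). pundecided d v w} \<le> gap d {v} (adj v)"
proof -
  let ?A = "pcav d {v} (adj v)" and ?A' = "pcav (Suc d) {v} (adj v)"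
  let ?S = "{w \<in> space (expos n). pundecided d v w}"
  have [measurable]: "?A \<in> borel_measurable (expos n)" "?A' \<in> borel_measurable (expos n)"
    using adj_subset[of v] assms by (auto intro!: pcav_measurable)
  have [measurable]: "?S \<in> sets (expos n)" by (rule pundecided_measurable[OF assms])
  have "emeasure (expos n) ?S = (\<integral>\<^sup>+w. indicator ?S w \<partial>expos n)" by simp
  also have "\<dots> = (\<integral>\<^sup>+w. (\<integral>\<^sup>+y. indicator ?S (w(v := y)) \<partial>expo) \<partial>expos n)"
    by (rule resample[OF assms]) measurable
  also have "\<dots> \<le> gap d {v} (adj v)"
    unfolding gap_def
  proof (rule nn_integral_mono)
    fix w assume w: "w \<in> space (expos n)"
    have local: "?A (w(v := y)) = ?A w" "?A' (w(v := y)) = ?A' w" for y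
      by (rule cav_cong; simp)+
    have nonneg: "0 \<le> ?A w" "0 \<le> ?A' w" by (rule cav_nonneg)+
    have "w(v := y) \<in> space (expos n)" for y
      using w assms by (auto simp: space_PiM PiE_def extensional_def)
    then have "(\<integral>\<^sup>+y. indicator ?S (w(v := y)) \<partial>expo)
        = (\<integral>\<^sup>+y. indicator {\<tau> + ?A w..\<tau> + ?A' w} y \<partial>expo)"
      using local by (intro nn_integral_cong) (auto simp: undecided_def split: split_indicator)
    also have "\<dots> = emeasure expo {\<tau> + ?A w..\<tau> + ?A' w}" by simp
    also have "\<dots> \<le> ennreal \<bar>exp (- (\<tau> + ?A w)) - exp (- (\<tau> + ?A' w))\<bar>"
      using nonneg \<tau>_nonneg by (intro emeasure_expo_interval) auto
    also have "exp (- (\<tau> + ?A w)) - exp (- (\<tau> + ?A' w)) = exp (- \<tau>) * (exp (- ?A w) - exp (- ?A' w))"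
      by (simp add: algebra_simps exp_add[symmetric] exp_diff)
    also have "ennreal \<bar>exp (- \<tau>) * (exp (- ?A w) - exp (- ?A' w))\<bar>
        \<le> ennreal (1 * \<bar>exp (- ?A w) - exp (- ?A' w)\<bar>)"
      unfolding abs_mult using \<tau>_nonneg by (intro ennreal_leI mult_right_mono) auto
    finally show "(\<integral>\<^sup>+y. indicator ?S (w(v := y)) \<partial>expo)
        \<le> ennreal \<bar>exp (- ?A w) - exp (- ?A' w)\<bar>" unfolding mult_1_left .
  qed
  finally show ?thesis .
qed

lemma prob_undecided:
  assumes "v < n"
  shows "emeasure (expos n) {w \<in> space (expos n). pundecided d v w} \<le> ennreal (3 / 2 * exp (- (\<tau> * d)))"
proof -
  note prob_undecided_le_gap[OF assms]
  also have "gap d {v} (adj v)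
      \<le> ennreal ((if d = 0 then 1 else card (set (adj v) - {v}) / 2) * exp (- (\<tau> * d)))"
    using assms by (intro gap_decay) auto
  also have "\<dots> \<le> ennreal (3 / 2 * exp (- (\<tau> * d)))"
  proof (intro ennreal_leI mult_right_mono)
    have "card (set (adj v) - {v}) \<le> 3"
      using deg_le_3[of v] assms card_length[of "adj v"] card_Diff1_le[of "set (adj v)" v] by simp
    then show "(if d = 0 then 1 else card (set (adj v) - {v}) / 2) \<le> 3 / 2" by simp
  qed simp
  finally show ?thesis .
qed

lemma AE_decided:
  assumes "n \<le> d"
  shows "AE w in expos n. \<forall>v<n. \<not> pundecided d v w"
proof -
  have "AE w in expos n. \<not> pundecided d v w" if "v \<in> {..<n}" for v
  proof -
    have v: "v < n" using that by simp
    have "card ({..<n} - {v}) \<le> d" using assms card_Diff1_le[of "{..<n}" v] by simp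
    then have "gap d {v} (adj v) = 0"
      unfolding gap_def using cav_saturated[of "adj v" "{v}" d] adj_subset[of v] v by simp
    then have "emeasure (expos n) {w \<in> space (expos n). pundecided d v w} = 0"
      using prob_undecided_le_gap[OF v, of d] by simp
    then show ?thesis
      using pundecided_measurable[OF v, of d] by (intro AE_I[where N = "{w \<in> space (expos n). pundecided d v w}"]) auto
  qed
  then have "AE w in expos n. \<forall>v\<in>{..<n}. \<not> pundecided d v w"
    by (subst AE_finite_all) auto
  then show ?thesis by (auto elim!: eventually_mono)
qed

lemma expected_loss:
  assumes "0 < a"
  shows "(\<integral>\<^sup>+w. ennreal (\<Sum>v<n. w v * of_bool (pundecided d v w)) \<partial>expos n)
     \<le> ennreal (n * (2 * a + 3 / 2 * exp (- (\<tau> * d)) / (4 * a)))"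
proof -
  let ?S = "\<lambda>v. {w \<in> space (expos n). pundecided d v w}"
  have [measurable]: "?S v \<in> sets (expos n)" if "v < n" for v
    by (rule pundecided_measurable[OF that])
  have comp [measurable]: "(\<lambda>w. w v) \<in> borel_measurable (expos n)" if "v < n" for v
    using that by (auto intro!: measurable_component_singleton)
  have "(\<integral>\<^sup>+w. ennreal (\<Sum>v<n. w v * of_bool (pundecided d v w)) \<partial>expos n)
      \<le> (\<integral>\<^sup>+w. (\<Sum>v<n. ennreal a * ennreal ((w v)\<^sup>2) + ennreal (1 / (4 * a)) * indicator (?S v) w) \<partial>expos n)"
  proof (rule nn_integral_mono)
    fix w assume w: "w \<in> space (expos n)"
    have "(\<Sum>v<n. w v * of_bool (pundecided d v w))
        \<le> (\<Sum>v<n. a * (w v)\<^sup>2 + of_bool (pundecided d v w) / (4 * a))"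
      by (intro sum_mono weighted_event_bound assms)
    then have "ennreal (\<Sum>v<n. w v * of_bool (pundecided d v w))
        \<le> ennreal (\<Sum>v<n. a * (w v)\<^sup>2 + of_bool (pundecided d v w) / (4 * a))"
      by (rule ennreal_leI)
    also have "\<dots> = (\<Sum>v<n. ennreal (a * (w v)\<^sup>2 + of_bool (pundecided d v w) / (4 * a)))"
      using assms by (subst sum_ennreal) auto
    also have "\<dots> = (\<Sum>v<n. ennreal a * ennreal ((w v)\<^sup>2) + ennreal (1 / (4 * a)) * indicator (?S v) w)"
      using assms w by (intro sum.cong refl)
        (auto simp: ennreal_mult'[symmetric] ennreal_plus[symmetric] split: split_indicator simp del: ennreal_plus)
    finally show "ennreal (\<Sum>v<n. w v * of_bool (pundecided d v w))
        \<le> (\<Sum>v<n. ennreal a * ennreal ((w v)\<^sup>2) + ennreal (1 / (4 * a)) * indicator (?S v) w)" .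
  qed
  also have "\<dots> = (\<Sum>v<n. \<integral>\<^sup>+w. ennreal a * ennreal ((w v)\<^sup>2) + ennreal (1 / (4 * a)) * indicator (?S v) w \<partial>expos n)"
    by (rule nn_integral_sum) measurable
  also have "\<dots> \<le> (\<Sum>v<n. ennreal (2 * a + 3 / 2 * exp (- (\<tau> * d)) / (4 * a)))"
  proof (rule sum_mono)
    fix v assume "v \<in> {..<n}"
    then have v: "v < n" by simp
    note [measurable] = comp[OF v]
    have "(\<integral>\<^sup>+w. ennreal a * ennreal ((w v)\<^sup>2) + ennreal (1 / (4 * a)) * indicator (?S v) w \<partial>expos n)
        = ennreal a * (\<integral>\<^sup>+w. ennreal ((w v)\<^sup>2) \<partial>expos n) + ennreal (1 / (4 * a)) * emeasure (expos n) (?S v)"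
      using v by (subst nn_integral_add) (auto simp: nn_integral_cmult)
    also have "(\<integral>\<^sup>+w. ennreal ((w v)\<^sup>2) \<partial>expos n) = (\<integral>\<^sup>+w. (\<integral>\<^sup>+y. ennreal (((w(v := y)) v)\<^sup>2) \<partial>expo) \<partial>expos n)"
      by (rule resample[OF v]) measurable
    also have "\<dots> = 2"
      using prob_space.emeasure_space_1[OF prob_space_expos[of n]] by (simp add: second_moment_expo)
    also have "ennreal a * 2 + ennreal (1 / (4 * a)) * emeasure (expos n) (?S v)
        \<le> ennreal a * ennreal 2 + ennreal (1 / (4 * a)) * ennreal (3 / 2 * exp (- (\<tau> * d)))"
      using prob_undecided[OF v, of d] by (intro add_mono mult_left_mono) auto
    also have "\<dots> = ennreal (a * 2) + ennreal (1 / (4 * a) * (3 / 2 * exp (- (\<tau> * d))))"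
      using assms by (subst ennreal_mult'[symmetric], simp, subst ennreal_mult'[symmetric], auto)
    also have "\<dots> = ennreal (2 * a + 3 / 2 * exp (- (\<tau> * d)) / (4 * a))"
      using assms by (subst ennreal_plus[symmetric]) (auto simp: mult.commute)
    finally show "(\<integral>\<^sup>+w. ennreal a * ennreal ((w v)\<^sup>2) + ennreal (1 / (4 * a)) * indicator (?S v) w \<partial>expos n)
        \<le> ennreal (2 * a + 3 / 2 * exp (- (\<tau> * d)) / (4 * a))" .
  qed
  also have "\<dots> = ennreal (n * (2 * a + 3 / 2 * exp (- (\<tau> * d)) / (4 * a)))"
    using assms by (simp add: ennreal_mult ennreal_of_nat_eq_real_of_nat)
  finally show ?thesis .
qed

section \<open>Failure probability\<close>

definition failure :: "nat \<Rightarrow> real \<Rightarrow> (nat \<Rightarrow> real) \<Rightarrow> bool" where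
  "failure d \<epsilon> w \<longleftrightarrow> ennreal (opt w {..<n}) / ennreal (sum w (chosen (\<lambda>v. w v - \<tau>) (Suc d))) > ennreal (1 + \<epsilon>)"

lemma failure_measurable: "{w \<in> space (expos n). failure d \<epsilon> w} \<in> sets (expos n)"
proof -
  have comp [measurable]: "(\<lambda>w. w v) \<in> borel_measurable (expos n)" if "v \<in> {..<n}" for v
    using that by (auto intro!: measurable_component_singleton)
  have [measurable]: "(\<lambda>w. sum w I) \<in> borel_measurable (expos n)" if "I \<subseteq> {..<n}" for I
    using that comp by (intro borel_measurable_sum) auto
  have [measurable]: "(\<lambda>w. opt w {..<n}) \<in> borel_measurable (expos n)"
    unfolding opt_def by (rule borel_measurable_Max[OF finite_indep_sets]) auto
  have chosen_sum: "sum w (chosen (\<lambda>v. w v - \<tau>) (Suc d))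
      = (\<Sum>v<n. if pcav (Suc d) {v} (adj v) w < w v - \<tau> then w v else 0)" for w
    unfolding chosen_def by (rule sum.inter_filter) simp
  have [measurable]: "(\<lambda>w. sum w (chosen (\<lambda>v. w v - \<tau>) (Suc d))) \<in> borel_measurable (expos n)"
    unfolding chosen_sum
  proof (rule borel_measurable_sum)
    fix v assume v: "v \<in> {..<n}"
    note [measurable] = comp[OF v]
    have [measurable]: "pcav (Suc d) {v} (adj v) \<in> borel_measurable (expos n)"
      using adj_subset[of v] v by (auto intro!: pcav_measurable)
    show "(\<lambda>w. if pcav (Suc d) {v} (adj v) w < w v - \<tau> then w v else 0) \<in> borel_measurable (expos n)"
      by (intro measurable_If borel_measurable_less) measurable
  qed
  show ?thesis unfolding failure_def by measurable
qed

lemma opt_nonneg: "0 \<le> opt w {..<n}"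
  using opt_ge[of "{}" "{..<n}" w] indep_empty by simp

lemma failure_imp:
  assumes "failure d \<epsilon> w" "\<forall>i<n. 0 \<le> w i" "0 < \<epsilon>"
  shows "(1 + \<epsilon>) * sum w (chosen (\<lambda>v. w v - \<tau>) (Suc d)) < opt w {..<n}"
proof (rule ccontr)
  let ?W = "sum w (chosen (\<lambda>v. w v - \<tau>) (Suc d))"
  assume "\<not> ?thesis"
  then have le: "opt w {..<n} \<le> (1 + \<epsilon>) * ?W" by simp
  have W: "0 \<le> ?W" using assms(2) by (intro sum_nonneg) (auto simp: chosen_def)
  have "ennreal (opt w {..<n}) / ennreal ?W \<le> ennreal (1 + \<epsilon>)"
  proof (cases "?W = 0")
    case True
    then have "opt w {..<n} = 0" using le opt_nonneg[of w] by simp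
    then show ?thesis by simp
  next
    case False
    then have "ennreal (opt w {..<n}) / ennreal ?W = ennreal (opt w {..<n} / ?W)"
      using W opt_nonneg by (intro divide_ennreal) auto
    also have "\<dots> \<le> ennreal (1 + \<epsilon>)"
      using False W le by (intro ennreal_leI) (simp add: divide_le_eq)
    finally show ?thesis .
  qed
  then show False using assms(1) unfolding failure_def by simp
qed

text \<open>
  For \<open>n \<le> d\<close> consecutive truncations agree, so a vertex is undecided only if its weight equals one value
  independent of it, which has probability 0. Without undecided vertices and without shift nothing is lost.
\<close>

lemma failure_prob_small:
  assumes "even d" "n \<le> d" "\<tau> = 0" "0 < \<epsilon>"
  shows "emeasure (expos n) {w \<in> space (expos n). failure d \<epsilon> w} = 0"
proof -
  have "AE w in expos n. \<not> failure d \<epsilon> w"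
    using AE_decided[OF assms(2)] AE_expos_nonneg[of n]
  proof eventually_elim
    case (elim w)
    let ?C = "chosen (\<lambda>v. w v - \<tau>) (Suc d)"
    have "(\<Sum>v<n. w v * of_bool (pundecided d v w)) = 0"
      using elim by (intro sum.neutral) auto
    then have "opt w {..<n} \<le> sum w ?C"
      using shifted_chosen_loss[OF assms(1) \<tau>_nonneg refl, of w] assms(3)
      by (simp only: mult_zero_left)
    also have "\<dots> \<le> (1 + \<epsilon>) * sum w ?C"
    proof -
      have "0 \<le> sum w ?C" using elim by (intro sum_nonneg) (auto simp: chosen_def)
      then show ?thesis using assms(4) by (simp add: algebra_simps)
    qed
    finally show ?case using failure_imp[of d \<epsilon> w] elim assms(4) by auto
  qed
  then show ?thesis using failure_measurable[of d \<epsilon>] by (subst AE_iff_measurable[symmetric]) auto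
qed

text \<open>
  In a failure, at least the fraction \<open>\<epsilon> / 2\<close> of the optimum is missing. Unless the total weight is
  below \<open>n / 2\<close>, the optimum is at least \<open>n / 8\<close>, so that at least \<open>\<epsilon> n / 16\<close> is missing. The shift explains at
  most \<open>\<epsilon> n / 32\<close> of it; the rest must be undecided weight, to which Markov's inequality applies.
\<close>

lemma failure_prob_large:
  assumes "even d" "d < n" "\<tau> = \<epsilon> / 32" "0 < \<epsilon>" "\<epsilon> \<le> 1" and d: "1500 / \<epsilon>\<^sup>2 \<le> d"
  shows "emeasure (expos n) {w \<in> space (expos n). failure d \<epsilon> w} \<le> ennreal \<epsilon>"
proof -
  let ?L = "\<lambda>w. \<Sum>v<n. w v * of_bool (pundecided d v w)"
  \<comment> \<open>With \<open>a = \<epsilon>\<^sup>2 / 256\<close> the second moment contributes \<open>\<epsilon> / 4\<close> to the Markov bound; the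
    undecided probability is then small enough to contribute less than \<open>\<epsilon> / 4\<close>.\<close>
  let ?c = "32 / (\<epsilon> * n)" and ?a = "\<epsilon>\<^sup>2 / 256"
  let ?light = "{w \<in> space (expos n). (\<Sum>i<n. w i) < real n / 2}"
  let ?lossy = "{w \<in> space (expos n). 1 \<le> ennreal ?c * ennreal (?L w)}"
  have n: "0 < n" using assms(2) by simp
  have comp: "(\<lambda>w. w v) \<in> borel_measurable (expos n)" if "v \<in> {..<n}" for v
    using that by (auto intro!: measurable_component_singleton)
  have light: "?light \<in> sets (expos n)"
    using comp by (intro borel_measurable_less borel_measurable_sum) auto
  have L: "?L \<in> borel_measurable (expos n)"
  proof (intro borel_measurable_sum borel_measurable_times comp)
    fix v assume "v \<in> {..<n}"
    then show "(\<lambda>w. of_bool (pundecided d v w) :: real) \<in> borel_measurable (expos n)"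
      using pundecided_measurable[of v d] unfolding of_bool_def by (intro measurable_If) auto
  qed
  have lossy: "?lossy \<in> sets (expos n)" using L by measurable
  have "emeasure (expos n) {w \<in> space (expos n). failure d \<epsilon> w} \<le> emeasure (expos n) (?light \<union> ?lossy)"
  proof (rule emeasure_mono_AE)
    show "AE w in expos n. w \<in> {w \<in> space (expos n). failure d \<epsilon> w} \<longrightarrow> w \<in> ?light \<union> ?lossy"
      using AE_expos_nonneg[of n]
    proof eventually_elim
      case (elim w)
      show ?case
      proof
        assume w: "w \<in> {w \<in> space (expos n). failure d \<epsilon> w}"
        show "w \<in> ?light \<union> ?lossy"
        proof (cases "(\<Sum>i<n. w i) < real n / 2")
          case False
          let ?J = "opt w {..<n}" and ?W = "sum w (chosen (\<lambda>v. w v - \<tau>) (Suc d))"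
          have J: "real n / 8 \<le> ?J" using False opt_ge_quarter[of w] elim by simp
          have "?J - ?W \<le> \<tau> * n + ?L w"
            using shifted_chosen_loss[OF assms(1) \<tau>_nonneg refl, of w] unfolding card_lessThan .
          moreover have "\<epsilon> / 2 * ?J \<le> ?J - ?W"
          proof -
            have "(1 + \<epsilon>) * ?W < ?J" using failure_imp[of d \<epsilon> w] w elim assms by auto
            then have "\<epsilon> * ?J \<le> (1 + \<epsilon>) * (?J - ?W)" by (simp add: algebra_simps)
            moreover have "0 \<le> ?J - ?W"
              using opt_ge[OF indep_chosen[OF assms(1), of "\<lambda>v. w v - \<tau>"], of "{..<n}" w]
              by (auto simp: chosen_def)
            then have "(1 + \<epsilon>) * (?J - ?W) \<le> 2 * (?J - ?W)"
              using assms(5) by (intro mult_right_mono) auto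
            ultimately show ?thesis by simp
          qed
          moreover have "\<epsilon> / 2 * (real n / 8) \<le> \<epsilon> / 2 * ?J" using J assms(4) by (intro mult_left_mono) auto
          moreover have "\<tau> * n = \<epsilon> * n / 32" "\<epsilon> / 2 * (real n / 8) = \<epsilon> * n / 16"
            using assms(3) by simp_all
          ultimately have "\<epsilon> * n / 32 \<le> ?L w" by linarith
          then have "1 \<le> ?c * ?L w" using assms(4) n by (simp add: field_simps)
          then have "1 \<le> ennreal ?c * ennreal (?L w)"
            using assms(4) by (subst ennreal_mult'[symmetric]) auto
          then show ?thesis using w by simp
        qed (use w in simp)
      qed
    qed
  qed (use light lossy in simp)
  also have "\<dots> \<le> emeasure (expos n) ?light + emeasure (expos n) ?lossy"
    by (rule emeasure_subadditive[OF light lossy])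
  also have "emeasure (expos n) ?light \<le> ennreal (\<epsilon> / 2)"
  proof -
    have "1500 / \<epsilon>\<^sup>2 \<le> n" using d assms(2) by linarith
    then show ?thesis
      using lower_tail_sum[of n] seven_eighths_power[OF assms(4,5), of n]
      by (meson ennreal_leI order_trans)
  qed
  also have "emeasure (expos n) ?lossy \<le> ennreal (\<epsilon> / 2)"
  proof -
    have "emeasure (expos n) ?lossy \<le> ennreal ?c * (\<integral>\<^sup>+w. ennreal (?L w) * indicator (space (expos n)) w \<partial>expos n)"
      using L nn_integral_Markov_inequality[of "\<lambda>w. ennreal (?L w)" "space (expos n)" "expos n" "ennreal ?c"]
      by simp
    also have "(\<integral>\<^sup>+w. ennreal (?L w) * indicator (space (expos n)) w \<partial>expos n) = (\<integral>\<^sup>+w. ennreal (?L w) \<partial>expos n)"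
      by (intro nn_integral_cong) auto
    also have "ennreal ?c * \<dots> \<le> ennreal ?c * ennreal (n * (2 * ?a + 3 / 2 * exp (- (\<tau> * d)) / (4 * ?a)))"
      using assms(4) by (intro mult_left_mono expected_loss) auto
    also have "\<dots> = ennreal (?c * (n * (2 * ?a + 3 / 2 * exp (- (\<tau> * d)) / (4 * ?a))))"
      using assms(4) by (subst ennreal_mult') auto
    also have "\<dots> \<le> ennreal (\<epsilon> / 2)"
    proof (rule ennreal_leI)
      have "?c * (n * (2 * ?a + 3 / 2 * exp (- (\<tau> * d)) / (4 * ?a)))
          = 32 / \<epsilon> * (2 * ?a + 3 / 2 * exp (- (\<tau> * d)) / (4 * ?a))" using n by simp
      also have "\<dots> \<le> 32 / \<epsilon> * (2 * ?a + 3 / 2 * (\<epsilon> ^ 4 / 14641) / (4 * ?a))"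
        using assms(4) exp_beats_quartic[OF assms(4,5) d] assms(3)
        by (intro mult_left_mono add_left_mono divide_right_mono) auto
      also have "\<dots> = \<epsilon> * (1 / 4 + 3072 / 14641)"
        using assms(4) by (simp add: field_simps power2_eq_square power4_eq_xxxx)
      also have "\<dots> \<le> \<epsilon> * (1 / 2)" using assms(4) by (intro mult_left_mono) auto
      finally show "?c * (n * (2 * ?a + 3 / 2 * exp (- (\<tau> * d)) / (4 * ?a))) \<le> \<epsilon> / 2" by simp
    qed
    finally show ?thesis .
  qed
  also have "ennreal (\<epsilon> / 2) + ennreal (\<epsilon> / 2) = ennreal \<epsilon>"
    using assms(4) by (subst ennreal_plus[symmetric]) auto
  finally show ?thesis by (simp add: add_mono)
qed

end

section \<open>Time-bounded execution\<close>

text \<open>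
  Commands without loops and coin flips denote functions on states, computed by \<open>run\<close>. On the
  other commands \<open>run\<close> and \<open>steps\<close> have dummy values.
\<close>

primrec loop_free :: "com \<Rightarrow> bool" where
  "loop_free Skip = True"
| "loop_free (NSet a i e) = True"
| "loop_free (RSet a i e) = True"
| "loop_free (Flip a i) = False"
| "loop_free (Emit e) = True"
| "loop_free (Seq c1 c2) = (loop_free c1 \<and> loop_free c2)"
| "loop_free (Cond b c1 c2) = (loop_free c1 \<and> loop_free c2)"
| "loop_free (While b c) = False"

primrec run :: "mwis_input \<Rightarrow> com \<Rightarrow> state \<Rightarrow> state" where
  "run inp Skip s = s"
| "run inp (NSet a i e) s =
    s\<lparr>nmem := (nmem s)(a := (nmem s a)(nval inp s i := nval inp s e))\<rparr>"
| "run inp (RSet a i e) s =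
    s\<lparr>rmem := (rmem s)(a := (rmem s a)(nval inp s i := rval inp s e))\<rparr>"
| "run inp (Flip a i) s = s"
| "run inp (Emit e) s = s\<lparr>emitted := insert (nval inp s e) (emitted s)\<rparr>"
| "run inp (Seq c1 c2) s = run inp c2 (run inp c1 s)"
| "run inp (Cond b c1 c2) s = (if bval inp s b then run inp c1 s else run inp c2 s)"
| "run inp (While b c) s = s"

primrec steps :: "com \<Rightarrow> nat" where
  "steps Skip = 1"
| "steps (NSet a i e) = 1"
| "steps (RSet a i e) = 1"
| "steps (Flip a i) = 1"
| "steps (Emit e) = 1"
| "steps (Seq c1 c2) = steps c1 + steps c2"
| "steps (Cond b c1 c2) = Suc (max (steps c1) (steps c2))"
| "steps (While b c) = 1"

lemma exec_run:
  "loop_free c \<Longrightarrow> \<exists>t\<le>steps c. exec inp \<omega> c s t (run inp c s)"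
proof (induction c arbitrary: s)
  case (Seq c1 c2)
  obtain t1 where 1: "t1 \<le> steps c1" "exec inp \<omega> c1 s t1 (run inp c1 s)" using Seq by auto
  obtain t2 where 2: "t2 \<le> steps c2" "exec inp \<omega> c2 (run inp c1 s) t2 (run inp c2 (run inp c1 s))"
    using Seq by auto
  show ?case using exec_Seq[OF 1(2) 2(2)] 1(1) 2(1) by (auto intro!: exI[of _ "t1 + t2"])
next
  case (Cond b c1 c2)
  show ?case
  proof (cases "bval inp s b")
    case True
    obtain t where "t \<le> steps c1" "exec inp \<omega> c1 s t (run inp c1 s)" using Cond by auto
    then show ?thesis using exec_CondTrue[of inp s b \<omega> c1 t _ c2] True by (auto intro!: exI[of _ "Suc t"])
  next
    case False
    obtain t where "t \<le> steps c2" "exec inp \<omega> c2 s t (run inp c2 s)" using Cond by auto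
    then show ?thesis using exec_CondFalse[of inp s b \<omega> c2 t _ c1] False by (auto intro!: exI[of _ "Suc t"])
  qed
qed (auto intro!: exI[of _ 1] intro: exec.intros simp del: One_nat_def)

text \<open>
  \<open>m\<close> completed passes of a loop, each within \<open>K\<close> steps, after which the loop may or may not continue. In
  contrast to \<open>exec\<close> of the whole loop, such stretches can be concatenated; an evaluation inside
  the stack machine is a stretch that does not end the loop.
\<close>

inductive passes ::
  "mwis_input \<Rightarrow> (nat \<Rightarrow> bool) \<Rightarrow> bexp \<Rightarrow> com \<Rightarrow> nat \<Rightarrow> nat \<Rightarrow> state \<Rightarrow> state \<Rightarrow> bool"
  for inp \<omega> b c K
where
  none: "passes inp \<omega> b c K 0 s s"
| pass: "bval inp s b \<Longrightarrow> exec inp \<omega> c s t s1 \<Longrightarrow> t \<le> K \<Longrightarrow> passes inp \<omega> b c K m s1 s2 \<Longrightarrow>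
    passes inp \<omega> b c K (Suc m) s s2"

lemma passes_trans:
  "passes inp \<omega> b c K m s1 s2 \<Longrightarrow> passes inp \<omega> b c K m' s2 s3 \<Longrightarrow> passes inp \<omega> b c K (m + m') s1 s3"
  by (induction rule: passes.induct) (auto intro: passes.intros)

lemma pass_run:
  assumes "bval inp s b" "loop_free c"
  shows "passes inp \<omega> b c (steps c) 1 s (run inp c s)"
  using exec_run[OF assms(2), of inp \<omega> s] assms(1) passes.pass passes.none
  by (metis One_nat_def)

lemma exec_While_passes:
  assumes "passes inp \<omega> b c K m s s'" "\<not> bval inp s' b"
  shows "\<exists>t \<le> m * Suc K + 1. exec inp \<omega> (While b c) s t s'"
  using assms
proof (induction rule: passes.induct)
  case (none s)
  then show ?case using exec_WhileFalse by auto
next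
  case (pass s t s1 m s2)
  obtain t' where "t' \<le> m * Suc K + 1" "exec inp \<omega> (While b c) s1 t' s2" using pass by auto
  then show ?case using exec_WhileTrue[OF pass(1,2)] pass(3)
    by (intro exI[of _ "Suc (t + t')"]) auto
qed

section \<open>The program\<close>

text \<open>
  Stack frames are numbered from 1, and \<open>sp\<close> is the number of the topmost one. A frame with \<open>vert = v\<close>,
  \<open>pos = k\<close> and \<open>depth = d\<close> stands for the call \<open>cav d X (drop k (adj v))\<close>, where \<open>X\<close> is the set of vertices
  marked in the array \<open>mark\<close>. Its \<open>phase\<close> tells what it waits for: 0 for nothing, 1 for the value of
  the child call at the next neighbour, 2 for that of the remaining neighbours. While it waits for the
  latter, \<open>part\<close> keeps the contribution of the child. Values are returned in \<open>ret\<close>.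
\<close>

abbreviation "sp \<equiv> NGet ''sp'' (NConst 0)"
abbreviation "ret \<equiv> RGet ''ret'' (NConst 0)"
abbreviation "tau \<equiv> RGet ''tau'' (NConst 0)"
abbreviation "radius \<equiv> NGet ''radius'' (NConst 0)"
abbreviation "cur \<equiv> NGet ''cur'' (NConst 0)"
abbreviation "top_field a \<equiv> NGet a sp"
abbreviation "next_nbr \<equiv> Nbr (top_field ''vert'') (top_field ''pos'')"

definition call :: "nexp \<Rightarrow> nexp \<Rightarrow> nexp \<Rightarrow> com" where
  "call v k d = Seq (NSet ''vert'' (NAdd sp (NConst 1)) v)
    (Seq (NSet ''pos'' (NAdd sp (NConst 1)) k)
    (Seq (NSet ''depth'' (NAdd sp (NConst 1)) d)
    (Seq (NSet ''phase'' (NAdd sp (NConst 1)) (NConst 0))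
         (NSet ''sp'' (NConst 0) (NAdd sp (NConst 1))))))"

definition return :: "rexp \<Rightarrow> com" where
  "return e = Seq (RSet ''ret'' (NConst 0) e) (NSet ''sp'' (NConst 0) (NSub sp (NConst 1)))"

definition positive_part :: "rexp \<Rightarrow> com" where
  "positive_part e = Cond (RLess (OfNat (NConst 0)) e)
     (RSet ''part'' sp e) (RSet ''part'' sp (OfNat (NConst 0)))"

text \<open>
  One transition of the stack machine. In phase 2 the neighbour whose contribution is complete is
  unmarked: both calls that needed it marked have returned.
\<close>

definition cav_step :: com where
  "cav_step =
    Cond (NLess (top_field ''phase'') (NConst 1))
      (Cond (BAnd (NLess (NConst 0) (top_field ''depth'')) (NLess (top_field ''pos'') (Deg (top_field ''vert''))))
        (Cond (NLess (NConst 0) (NGet ''mark'' next_nbr))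
          (NSet ''pos'' sp (NAdd (top_field ''pos'') (NConst 1)))
          (Seq (NSet ''mark'' next_nbr (NConst 1))
          (Seq (NSet ''phase'' sp (NConst 1))
               (call next_nbr (NConst 0) (NSub (top_field ''depth'') (NConst 1))))))
        (return (OfNat (NConst 0))))
      (Cond (NLess (top_field ''phase'') (NConst 2))
        (Seq (positive_part (RSub (RSub (Weight next_nbr) tau) ret))
        (Seq (NSet ''phase'' sp (NConst 2))
             (call (top_field ''vert'') (NAdd (top_field ''pos'') (NConst 1)) (top_field ''depth''))))
        (Seq (NSet ''mark'' next_nbr (NConst 0))
             (return (RAdd (RGet ''part'' sp) ret))))"

definition cav_loop :: com where
  "cav_loop = While (NLess (NConst 0) sp) cav_step"

lemma loop_free_cav_step: "loop_free cav_step"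
  by (simp add: cav_step_def call_def return_def positive_part_def)

definition marks :: "state \<Rightarrow> nat set \<Rightarrow> bool" where
  "marks s X \<longleftrightarrow> (\<forall>u. nmem s ''mark'' u = of_bool (u \<in> X))"

definition frame :: "state \<Rightarrow> nat \<Rightarrow> nat \<Rightarrow> nat \<Rightarrow> nat \<Rightarrow> nat \<Rightarrow> bool" where
  "frame s p v k d ph \<longleftrightarrow> nmem s ''vert'' p = v \<and> nmem s ''pos'' p = k \<and>
     nmem s ''depth'' p = d \<and> nmem s ''phase'' p = ph"

text \<open>
  What an evaluation started with top frame \<open>p\<close> leaves intact: the frames of its callers and the variables
  of the main program.
\<close>

definition same_below :: "nat \<Rightarrow> state \<Rightarrow> state \<Rightarrow> bool" where
  "same_below p s s' \<longleftrightarrow>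
     (\<forall>a\<in>{''vert'', ''pos'', ''depth'', ''phase''}. \<forall>i<p. nmem s' a i = nmem s a i) \<and>
     (\<forall>i<p. rmem s' ''part'' i = rmem s ''part'' i) \<and>
     nmem s' ''radius'' = nmem s ''radius'' \<and> nmem s' ''cur'' = nmem s ''cur'' \<and>
     rmem s' ''tau'' = rmem s ''tau'' \<and> emitted s' = emitted s"

lemma same_below_trans:
  "same_below p s1 s2 \<Longrightarrow> same_below p' s2 s3 \<Longrightarrow> p \<le> p' \<Longrightarrow> same_below p s1 s3"
  unfolding same_below_def by simp

text \<open>
  The machine cannot round reals to naturals, so the depth is found by counting. It starts at 1 and grows in steps of
  2 to stay odd, which makes the truncations upper bounds.
\<close>

definition grow_radius :: com where
  "grow_radius = Seq (NSet ''radius'' (NConst 0) (NConst 1))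
    (While (RLess (RMul (OfNat radius) (RMul Accuracy Accuracy)) (OfNat (NConst 2048)))
      (NSet ''radius'' (NConst 0) (NAdd radius (NConst 2))))"

definition set_tau :: com where
  "set_tau = Cond (NLess NumVerts radius) Skip
    (RSet ''tau'' (NConst 0) (RDiv Accuracy (OfNat (NConst 32))))"

definition start_vertex :: com where
  "start_vertex = Seq (NSet ''mark'' cur (NConst 1)) (call cur (NConst 0) radius)"

definition finish_vertex :: com where
  "finish_vertex = Seq (NSet ''mark'' cur (NConst 0))
    (Seq (Cond (RLess ret (RSub (Weight cur) tau)) (Emit cur) Skip)
         (NSet ''cur'' (NConst 0) (NAdd cur (NConst 1))))"

definition cavity_alg :: com where
  "cavity_alg = Seq grow_radius (Seq set_tau
    (While (NLess cur NumVerts) (Seq start_vertex (Seq cav_loop finish_vertex))))"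

text \<open>
  The largest even number below the odd recursion depth \<open>Suc (depth_for \<epsilon>)\<close> used by the program; vertices are
  undecided between these two truncations.
\<close>

definition depth_for :: "real \<Rightarrow> nat" where
  "depth_for \<epsilon> = 2 * (LEAST m. 2048 \<le> real (2 * m + 1) * (\<epsilon> * \<epsilon>))"

definition shift_for :: "nat \<Rightarrow> real \<Rightarrow> real" where
  "shift_for n \<epsilon> = (if n \<le> depth_for \<epsilon> then 0 else \<epsilon> / 32)"

lemma depth_for_even: "even (depth_for \<epsilon>)"
  by (simp add: depth_for_def)

lemma depth_for_exists:
  assumes "0 < \<epsilon>"
  shows "\<exists>m. 2048 \<le> real (2 * m + 1) * (\<epsilon> * \<epsilon>)"
proof -
  obtain m :: nat where "2048 / (\<epsilon> * \<epsilon>) < m" using reals_Archimedean2 by blast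
  then have "2048 < m * (\<epsilon> * \<epsilon>)" using assms by (subst (asm) pos_divide_less_eq) simp_all
  also have "\<dots> \<le> real (2 * m + 1) * (\<epsilon> * \<epsilon>)" by (intro mult_right_mono) auto
  finally show ?thesis by (auto intro: less_imp_le)
qed

lemma depth_for_large:
  assumes "0 < \<epsilon>"
  shows "2048 \<le> real (depth_for \<epsilon> + 1) * (\<epsilon> * \<epsilon>)"
  unfolding depth_for_def by (fact LeastI_ex[OF depth_for_exists[OF assms]])

lemma depth_for_minimal:
  assumes "2 * m < depth_for \<epsilon>"
  shows "real (2 * m + 1) * (\<epsilon> * \<epsilon>) < 2048"
proof -
  have "m < (LEAST m. 2048 \<le> real (2 * m + 1) * (\<epsilon> * \<epsilon>))"
    using assms by (simp add: depth_for_def)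
  from not_less_Least[OF this] show ?thesis by (simp only: not_le)
qed

lemma depth_for_le:
  assumes "0 < \<epsilon>"
  shows "real (depth_for \<epsilon>) \<le> 2048 / \<epsilon>\<^sup>2 + 1"
proof (cases "depth_for \<epsilon> = 0")
  case True
  then show ?thesis by (simp only: of_nat_0) (intro add_nonneg_nonneg divide_nonneg_nonneg; simp)
next
  case False
  obtain h where h: "depth_for \<epsilon> = 2 * h" using depth_for_even[of \<epsilon>] by (rule evenE)
  have "h = Suc (h - 1)" using False h by linarith
  then have m: "depth_for \<epsilon> = 2 * (h - 1) + 2" using h by linarith
  then have "real (2 * (h - 1) + 1) * (\<epsilon> * \<epsilon>) < 2048"
    using depth_for_minimal[of "h - 1" \<epsilon>] by linarith
  then have *: "real (2 * (h - 1) + 1) < 2048 / \<epsilon>\<^sup>2"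
    unfolding power2_eq_square using assms by (subst pos_less_divide_eq) (rule mult_pos_pos, assumption+)
  have "real (depth_for \<epsilon>) = real (2 * (h - 1) + 1) + 1" unfolding m by simp
  also have "\<dots> \<le> 2048 / \<epsilon>\<^sup>2 + 1" using * by (intro add_right_mono less_imp_le)
  finally show ?thesis .
qed

context
  fixes n :: nat and adj :: "nat \<Rightarrow> nat list" and w :: "nat \<Rightarrow> real" and \<epsilon> :: real and inp :: mwis_input
  defines inp_def: "inp \<equiv> input_of n adj w \<epsilon>"
begin

lemma inp_simps [simp]: "num_verts inp = n" "nbrs inp = adj" "wgt inp = w" "accuracy inp = \<epsilon>"
  by (simp_all add: inp_def input_of_def)

text \<open>
  The five transitions: an exhausted call returns 0, a deleted neighbour is skipped, a neighbour is
  marked and its child call started, its contribution is stored and the call for the remaining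
  neighbours started, and finally both values are added up.
\<close>

lemma step_return:
  assumes "nmem s ''sp'' 0 = p" "frame s p v k d 0" "v < n" "d = 0 \<or> length (adj v) \<le> k"
  defines "s' \<equiv> run inp cav_step s"
  shows "nmem s' ''sp'' 0 = p - 1" "rmem s' ''ret'' 0 = 0" "nmem s' ''mark'' = nmem s ''mark''"
    "same_below p s s'"
  using assms(1-4) unfolding s'_def
  by (auto simp: cav_step_def return_def frame_def same_below_def)

lemma step_skip:
  assumes "nmem s ''sp'' 0 = p" "frame s p v k (Suc d) 0" "v < n" "k < length (adj v)"
    and "marks s X" "adj v ! k \<in> X"
  defines "s' \<equiv> run inp cav_step s"
  shows "nmem s' ''sp'' 0 = p" "frame s' p v (Suc k) (Suc d) 0" "marks s' X" "same_below p s s'"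
  using assms(1-6) unfolding s'_def
  by (auto simp: cav_step_def frame_def same_below_def marks_def)

lemma step_descend:
  assumes "nmem s ''sp'' 0 = p" "frame s p v k (Suc d) 0" "v < n" "k < length (adj v)"
    and "marks s X" "adj v ! k \<notin> X"
  defines "s' \<equiv> run inp cav_step s"
  shows "nmem s' ''sp'' 0 = Suc p" "frame s' (Suc p) (adj v ! k) 0 d 0" "frame s' p v k (Suc d) 1"
    "marks s' (insert (adj v ! k) X)" "same_below p s s'"
  using assms(1-6) unfolding s'_def
  by (auto simp: cav_step_def call_def frame_def same_below_def marks_def)

lemma step_advance:
  assumes "nmem s ''sp'' 0 = p" "frame s p v k (Suc d) 1" "v < n" "k < length (adj v)" "adj v ! k < n"
    and "marks s X" "rmem s ''tau'' 0 = \<tau>"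
  defines "s' \<equiv> run inp cav_step s"
  shows "nmem s' ''sp'' 0 = Suc p" "frame s' (Suc p) v (Suc k) (Suc d) 0" "frame s' p v k (Suc d) 2"
    "marks s' X" "same_below p s s'"
    "rmem s' ''part'' p = max 0 (w (adj v ! k) - \<tau> - rmem s ''ret'' 0)"
  using assms(1-7) unfolding s'_def
  by (auto simp: cav_step_def call_def positive_part_def frame_def same_below_def marks_def max_def)

lemma step_ascend:
  assumes "nmem s ''sp'' 0 = p" "frame s p v k (Suc d) 2" "v < n" "k < length (adj v)"
    and "marks s (insert (adj v ! k) X)" "adj v ! k \<notin> X"
  defines "s' \<equiv> run inp cav_step s"
  shows "nmem s' ''sp'' 0 = p - 1" "rmem s' ''ret'' 0 = rmem s ''part'' p + rmem s ''ret'' 0"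
    "marks s' X" "same_below p s s'"
  using assms(1-6) unfolding s'_def
  by (auto simp: cav_step_def return_def frame_def same_below_def marks_def)

lemma pass_cav_step:
  "0 < nmem s ''sp'' 0 \<Longrightarrow>
    passes inp \<omega> (NLess (NConst 0) sp) cav_step (steps cav_step) 1 s (run inp cav_step s)"
  by (rule pass_run) (auto simp: loop_free_cav_step)

text \<open>
  The stack machine evaluates the top frame, leaves the marks as they were and pops the frame. The
  bound on the number of passes follows the recursion: a child has at most three neighbours, so a
  neighbour costs at most \<open>3 + 4 * 8 ^ d \<le> 8 ^ Suc d\<close> passes besides those for the remaining ones.
\<close>

lemma cav_passes:
  assumes "\<And>v. v < n \<Longrightarrow> set (adj v) \<subseteq> {..<n}" "\<And>v. v < n \<Longrightarrow> length (adj v) \<le> 3"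
    and "v < n" "us = drop k (adj v)"
    and "nmem s ''sp'' 0 = p" "0 < p" "frame s p v k d 0" "marks s X" "rmem s ''tau'' 0 = \<tau>"
  shows "\<exists>m s'. passes inp \<omega> (NLess (NConst 0) sp) cav_step (steps cav_step) m s s' \<and>
    m \<le> (length us + 1) * 8 ^ d \<and> nmem s' ''sp'' 0 = p - 1 \<and>
    rmem s' ''ret'' 0 = cav adj (\<lambda>v. w v - \<tau>) d X us \<and> marks s' X \<and> same_below p s s'"
  using assms(3-)
proof (induction d X us arbitrary: v k s p rule: cav_induct[where adj = adj])
  case (zero X us)
  note ret = step_return[OF zero(3,5,1), folded inp_def, simplified]
  show ?case
    using pass_cav_step[of s \<omega>] zero ret
    by (intro exI[of _ 1] exI[of _ "run inp cav_step s"]) (auto simp: marks_def)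
next
  case (nil d X)
  have "length (adj v) \<le> k" using nil(2) by simp
  then have "Suc d = 0 \<or> length (adj v) \<le> k" by simp
  note ret = step_return[OF nil(3,5,1) this, folded inp_def]
  show ?case
    using pass_cav_step[of s \<omega>] nil ret
    by (intro exI[of _ 1] exI[of _ "run inp cav_step s"]) (auto simp: marks_def)
next
  case (cons d X u us)
  have k: "k < length (adj v)" using cons.prems(2) by (metis drop_eq_Nil leI list.distinct(1))
  then have u: "adj v ! k = u" and us: "us = drop (Suc k) (adj v)"
    using cons.prems(2) by (metis Cons_nth_drop_Suc list.inject)+
  have un: "u < n" using k u cons.prems(1) assms(1)[of v] nth_mem[of k "adj v"] by auto
  let ?P = "passes inp \<omega> (NLess (NConst 0) sp) cav_step (steps cav_step)"
  let ?s1 = "run inp cav_step s"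
  have first: "?P 1 s ?s1" using pass_cav_step cons.prems by simp
  show ?case
  proof (cases "u \<in> X")
    case True
    note skip = step_skip[OF cons.prems(3,5,1) k cons.prems(6), unfolded u, OF True, folded inp_def]
    obtain m s' where m: "?P m ?s1 s'" "m \<le> (length us + 1) * 8 ^ Suc d" "nmem s' ''sp'' 0 = p - 1"
      "rmem s' ''ret'' 0 = cav adj (\<lambda>v. w v - \<tau>) (Suc d) X us" "marks s' X" "same_below p ?s1 s'"
      using cons.IH(1)[OF True cons.prems(1) us skip(1) cons.prems(4) skip(2,3)] skip(4) cons.prems(7)
      by (auto simp: same_below_def)
    have "1 + m \<le> (length (u # us) + 1) * 8 ^ Suc d"
    proof -
      have "1 + m \<le> 8 ^ Suc d + (length us + 1) * 8 ^ Suc d"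
        using m(2) by (intro add_mono one_le_power) auto
      then show ?thesis by simp
    qed
    then show ?thesis
      using passes_trans[OF first m(1)] m True same_below_trans[OF skip(4) m(6) order_refl]
      by (intro exI[of _ "1 + m"] exI[of _ s']) auto
  next
    case False
    note desc = step_descend[OF cons.prems(3,5,1) k cons.prems(6), unfolded u, OF False, folded inp_def]
    obtain m2 s2 where m2: "?P m2 ?s1 s2" "m2 \<le> (length (adj u) + 1) * 8 ^ d" "nmem s2 ''sp'' 0 = p"
      "rmem s2 ''ret'' 0 = cav adj (\<lambda>v. w v - \<tau>) d (insert u X) (adj u)"
      "marks s2 (insert u X)" "same_below (Suc p) ?s1 s2"
      using cons.IH(2)[OF False un _ desc(1) _ desc(2,4)] desc(5) cons.prems(7)
      by (auto simp: same_below_def)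
    have s2: "frame s2 p v k (Suc d) 1" "rmem s2 ''tau'' 0 = \<tau>"
      using m2(6) desc(3,5) cons.prems(7) by (auto simp: same_below_def frame_def)
    let ?s3 = "run inp cav_step s2"
    have third: "?P 1 s2 ?s3" using pass_cav_step m2(3) cons.prems(4) by simp
    have un': "adj v ! k < n" using un u by simp
    note adv = step_advance[OF m2(3) s2(1) cons.prems(1) k un' m2(5) s2(2), unfolded u, folded inp_def]
    obtain m4 s4 where m4: "?P m4 ?s3 s4" "m4 \<le> (length us + 1) * 8 ^ Suc d" "nmem s4 ''sp'' 0 = p"
      "rmem s4 ''ret'' 0 = cav adj (\<lambda>v. w v - \<tau>) (Suc d) (insert u X) us"
      "marks s4 (insert u X)" "same_below (Suc p) ?s3 s4"
      using cons.IH(3)[OF False cons.prems(1) us adv(1) _ adv(2,4)] adv(5) s2(2)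
      by (auto simp: same_below_def)
    have s4: "frame s4 p v k (Suc d) 2" "rmem s4 ''part'' p = rmem ?s3 ''part'' p"
      using m4(6) adv(3) by (auto simp: same_below_def frame_def)
    let ?s5 = "run inp cav_step s4"
    have fifth: "?P 1 s4 ?s5" using pass_cav_step m4(3) cons.prems(4) by simp
    note asc = step_ascend[OF m4(3) s4(1) cons.prems(1) k, unfolded u, OF m4(5) False, folded inp_def]
    have P: "?P (1 + (m2 + (1 + (m4 + 1)))) s ?s5"
      using passes_trans[OF first passes_trans[OF m2(1) passes_trans[OF third passes_trans[OF m4(1) fifth]]]] .
    have below: "same_below p s ?s5"
    proof -
      have "same_below p s s2" using same_below_trans[OF desc(5) m2(6)] by simp
      then have "same_below p s ?s3" using same_below_trans[OF _ adv(5)] by simp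
      then have "same_below p s s4" using same_below_trans[OF _ m4(6)] by simp
      then show ?thesis using same_below_trans[OF _ asc(4)] by simp
    qed
    have val: "rmem ?s5 ''ret'' 0 = cav adj (\<lambda>v. w v - \<tau>) (Suc d) X (u # us)"
      using False by (simp add: asc(2) s4(2) adv(6) m2(4) m4(4))
    have "1 + (m2 + (1 + (m4 + 1))) \<le> (length (u # us) + 1) * 8 ^ Suc d"
    proof -
      have "(length (adj u) + 1) * 8 ^ d \<le> 4 * 8 ^ d"
        using assms(2)[OF un] by (intro mult_le_mono1) simp
      moreover have "1 \<le> (8 :: nat) ^ d" by (rule one_le_power) simp
      moreover have "(length (u # us) + 1) * 8 ^ Suc d = (length us + 1) * 8 ^ Suc d + 8 * 8 ^ d"
        by simp
      ultimately show ?thesis using m2(2) m4(2) by linarith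
    qed
    then show ?thesis
      by (intro exI[of _ "1 + (m2 + (1 + (m4 + 1)))"] exI[of _ ?s5] conjI P below val asc(1,3))
  qed
qed

lemma grow_radius_exec:
  assumes "0 < \<epsilon>"
  defines "s' \<equiv> init_state\<lparr>nmem := (nmem init_state)(''radius'' := (nmem init_state ''radius'')(0 := depth_for \<epsilon> + 1))\<rparr>"
  shows "\<exists>t \<le> depth_for \<epsilon> + 2. exec inp \<omega> grow_radius init_state t s'"
proof -
  let ?s = "\<lambda>m. init_state\<lparr>nmem := (nmem init_state)(''radius'' := (nmem init_state ''radius'')(0 := 2 * m + 1))\<rparr>"
  let ?b = "RLess (RMul (OfNat radius) (RMul Accuracy Accuracy)) (OfNat (NConst 2048))"
  let ?c = "NSet ''radius'' (NConst 0) (NAdd radius (NConst 2))"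
  have loop: "passes inp \<omega> ?b ?c 1 m (?s 0) (?s m)" if "2 * m \<le> depth_for \<epsilon>" for m
    using that
  proof (induction m)
    case 0
    show ?case by (rule passes.none)
  next
    case (Suc m)
    have "bval inp (?s m) ?b" using depth_for_minimal[of m \<epsilon>] Suc.prems by simp
    then have "passes inp \<omega> ?b ?c (steps ?c) 1 (?s m) (run inp ?c (?s m))"
      by (rule pass_run) simp
    moreover have "run inp ?c (?s m) = ?s (Suc m)" by simp
    ultimately have "passes inp \<omega> ?b ?c 1 1 (?s m) (?s (Suc m))"
      by (simp only: steps.simps)
    moreover have "passes inp \<omega> ?b ?c 1 m (?s 0) (?s m)"
      by (rule Suc.IH) (use Suc.prems in simp)
    ultimately show ?case
      using passes_trans[of inp \<omega> ?b ?c 1 m "?s 0" "?s m" 1 "?s (Suc m)"] by (simp only: Suc_eq_plus1)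
  qed
  obtain h where h: "depth_for \<epsilon> = 2 * h" using depth_for_even[of \<epsilon>] by (rule evenE)
  have "passes inp \<omega> ?b ?c 1 h (?s 0) s'" using loop[of h] h by (simp add: s'_def)
  moreover have "\<not> bval inp s' ?b" using depth_for_large[OF assms(1)] by (simp add: s'_def)
  ultimately obtain t where t: "t \<le> h * Suc 1 + 1" "exec inp \<omega> (While ?b ?c) (?s 0) t s'"
    using exec_While_passes by blast
  have "exec inp \<omega> (NSet ''radius'' (NConst 0) (NConst 1)) init_state 1 (?s 0)"
    using exec_NSet[of inp \<omega> "''radius''" "NConst 0" "NConst 1" init_state] by simp
  from exec_Seq[OF this t(2)] show ?thesis
    unfolding grow_radius_def using t(1) h by (intro exI[of _ "1 + t"]) auto
qed

definition scanned :: "nat \<Rightarrow> real \<Rightarrow> nat \<Rightarrow> nat \<Rightarrow> state \<Rightarrow> bool" where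
  "scanned r \<tau> d j s \<longleftrightarrow> nmem s ''cur'' 0 = j \<and> nmem s ''sp'' 0 = 0 \<and> marks s {} \<and>
     nmem s ''radius'' 0 = r \<and> rmem s ''tau'' 0 = \<tau> \<and>
     emitted s = {v. v < j \<and> cav adj (\<lambda>v. w v - \<tau>) d {v} (adj v) < w v - \<tau>}"

definition vertex_cost :: "nat \<Rightarrow> nat" where
  "vertex_cost d = steps start_vertex + (4 * 8 ^ d * Suc (steps cav_step) + 1) + steps finish_vertex"

lemma scan_vertex:
  assumes "\<And>v. v < n \<Longrightarrow> set (adj v) \<subseteq> {..<n}" "\<And>v. v < n \<Longrightarrow> length (adj v) \<le> 3"
    and "j < n" "scanned d \<tau> d j s"
  shows "\<exists>t s'. exec inp \<omega> (Seq start_vertex (Seq cav_loop finish_vertex)) s t s' \<and>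
    t \<le> vertex_cost d \<and> scanned d \<tau> d (Suc j) s'"
proof -
  let ?s1 = "run inp start_vertex s"
  obtain t1 where t1: "t1 \<le> steps start_vertex" "exec inp \<omega> start_vertex s t1 ?s1"
    using exec_run[of start_vertex inp \<omega> s] by (auto simp: start_vertex_def call_def)
  have s1: "nmem ?s1 ''sp'' 0 = 1" "frame ?s1 1 j 0 d 0" "marks ?s1 {j}" "rmem ?s1 ''tau'' 0 = \<tau>"
    "same_below 0 s ?s1"
    using assms(4) by (auto simp: start_vertex_def call_def scanned_def frame_def marks_def same_below_def)
  obtain m s2 where m: "passes inp \<omega> (NLess (NConst 0) sp) cav_step (steps cav_step) m ?s1 s2"
    "m \<le> (length (adj j) + 1) * 8 ^ d" "nmem s2 ''sp'' 0 = 0"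
    "rmem s2 ''ret'' 0 = cav adj (\<lambda>v. w v - \<tau>) d {j} (adj j)" "marks s2 {j}" "same_below 1 ?s1 s2"
    using cav_passes[of j "adj j" 0 ?s1 1 d "{j}" \<tau> \<omega>, OF assms(1,2)] assms(3) s1 by auto
  have "\<not> bval inp s2 (NLess (NConst 0) sp)" using m(3) by simp
  then obtain t2 where t2: "t2 \<le> m * Suc (steps cav_step) + 1" "exec inp \<omega> cav_loop ?s1 t2 s2"
    using exec_While_passes[OF m(1)] unfolding cav_loop_def by blast
  let ?s3 = "run inp finish_vertex s2"
  obtain t3 where t3: "t3 \<le> steps finish_vertex" "exec inp \<omega> finish_vertex s2 t3 ?s3"
    using exec_run[of finish_vertex inp \<omega> s2] by (auto simp: finish_vertex_def)
  have below: "same_below 0 s s2" using same_below_trans[OF s1(5) m(6)] by simp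
  have s2: "nmem s2 ''cur'' 0 = j" "nmem s2 ''radius'' 0 = d" "rmem s2 ''tau'' 0 = \<tau>"
    "emitted s2 = {v. v < j \<and> cav adj (\<lambda>v. w v - \<tau>) d {v} (adj v) < w v - \<tau>}"
    using below assms(4) by (auto simp: same_below_def scanned_def)
  have "scanned d \<tau> d (Suc j) ?s3"
    using s2 m(3,4,5) assms(3)
    by (auto simp: scanned_def finish_vertex_def marks_def less_Suc_eq)
  moreover have "t1 + (t2 + t3) \<le> vertex_cost d"
  proof -
    have "(length (adj j) + 1) * 8 ^ d \<le> 4 * 8 ^ d"
      using assms(2)[OF assms(3)] by (intro mult_le_mono1) simp
    with m(2) have "m \<le> 4 * 8 ^ d" by (rule order_trans)
    then have "m * Suc (steps cav_step) \<le> 4 * 8 ^ d * Suc (steps cav_step)" by (rule mult_le_mono1)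
    then show ?thesis using t1(1) t2(1) t3(1) unfolding vertex_cost_def by linarith
  qed
  ultimately show ?thesis using exec_Seq[OF t1(2) exec_Seq[OF t2(2) t3(2)]] by blast
qed

lemma scan_all:
  assumes "\<And>v. v < n \<Longrightarrow> set (adj v) \<subseteq> {..<n}" "\<And>v. v < n \<Longrightarrow> length (adj v) \<le> 3"
    and "scanned d \<tau> d 0 s"
  shows "\<exists>t s'. exec inp \<omega> (While (NLess cur NumVerts) (Seq start_vertex (Seq cav_loop finish_vertex))) s t s' \<and>
    t \<le> n * Suc (vertex_cost d) + 1 \<and> scanned d \<tau> d n s'"
proof -
  let ?c = "Seq start_vertex (Seq cav_loop finish_vertex)"
  have "\<exists>s'. passes inp \<omega> (NLess cur NumVerts) ?c (vertex_cost d) j s s' \<and> scanned d \<tau> d j s'"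
    if "j \<le> n" for j
    using that
  proof (induction j)
    case 0
    show ?case using passes.none assms(3) by blast
  next
    case (Suc j)
    then obtain s' where s': "passes inp \<omega> (NLess cur NumVerts) ?c (vertex_cost d) j s s'" "scanned d \<tau> d j s'"
      by auto
    obtain t s'' where s'': "exec inp \<omega> ?c s' t s''" "t \<le> vertex_cost d" "scanned d \<tau> d (Suc j) s''"
      using scan_vertex[OF assms(1,2) Suc_le_lessD[OF Suc.prems] s'(2), of \<omega>] by blast
    have "bval inp s' (NLess cur NumVerts)" using s'(2) Suc.prems by (simp add: scanned_def)
    then have "passes inp \<omega> (NLess cur NumVerts) ?c (vertex_cost d) (Suc 0) s' s''"
      using passes.pass[OF _ s''(1,2) passes.none] by simp
    then show ?case using passes_trans[OF s'(1)] s''(3) by fastforce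
  qed
  then obtain s' where "passes inp \<omega> (NLess cur NumVerts) ?c (vertex_cost d) n s s'" "scanned d \<tau> d n s'"
    by blast
  moreover from this have "\<not> bval inp s' (NLess cur NumVerts)" by (simp add: scanned_def)
  ultimately show ?thesis using exec_While_passes by blast
qed

lemma cavity_alg_outputs:
  assumes "\<And>v. v < n \<Longrightarrow> set (adj v) \<subseteq> {..<n}" "\<And>v. v < n \<Longrightarrow> length (adj v) \<le> 3" "0 < \<epsilon>"
  defines "d \<equiv> Suc (depth_for \<epsilon>)" and "\<tau> \<equiv> shift_for n \<epsilon>"
  shows "\<exists>t \<le> d + 4 + n * Suc (vertex_cost d).
    outputs cavity_alg inp \<omega> t {v. v < n \<and> cav adj (\<lambda>v. w v - \<tau>) d {v} (adj v) < w v - \<tau>}"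
proof -
  let ?s1 = "init_state\<lparr>nmem := (nmem init_state)(''radius'' := (nmem init_state ''radius'')(0 := depth_for \<epsilon> + 1))\<rparr>"
  obtain t1 where t1: "t1 \<le> depth_for \<epsilon> + 2" "exec inp \<omega> grow_radius init_state t1 ?s1"
    using grow_radius_exec[OF assms(3)] by blast
  let ?s2 = "run inp set_tau ?s1"
  obtain t2 where t2: "t2 \<le> 2" "exec inp \<omega> set_tau ?s1 t2 ?s2"
  proof -
    have "loop_free set_tau" "steps set_tau = 2" by (simp_all add: set_tau_def)
    then show ?thesis using exec_run[of set_tau inp \<omega> ?s1] that by auto
  qed
  have "scanned d \<tau> d 0 ?s2"
    by (auto simp: scanned_def set_tau_def init_state_def marks_def d_def \<tau>_def shift_for_def)
  then obtain t3 s3 where t3: "exec inp \<omega> (While (NLess cur NumVerts) (Seq start_vertex (Seq cav_loop finish_vertex))) ?s2 t3 s3"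
    "t3 \<le> n * Suc (vertex_cost d) + 1" "scanned d \<tau> d n s3"
    using scan_all[OF assms(1,2)] by blast
  have "exec inp \<omega> cavity_alg init_state (t1 + (t2 + t3)) s3"
    unfolding cavity_alg_def by (rule exec_Seq[OF t1(2) exec_Seq[OF t2(2) t3(1)]])
  then show ?thesis
    using t1(1) t2(1) t3(2,3) unfolding outputs_def d_def
    by (intro exI[of _ "t1 + (t2 + t3)"]) (auto simp: scanned_def)
qed

end

section \<open>The approximation scheme\<close>

lemma input_graph_of_presentation:
  assumes "presents_graph n adj G" "max_degree G \<le> 3"
  shows "input_graph n adj"
proof
  interpret pair_graph G using assms(1) by (simp add: presents_graph_def)
  have V: "pverts G = {..<n}" and
    adj: "\<And>v. v < n \<Longrightarrow> distinct (adj v)" "\<And>v. v < n \<Longrightarrow> set (adj v) = {u. (v, u) \<in> parcs G}"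
    using assms(1) by (auto simp: presents_graph_def)
  show "finite {..<n}" by simp
  fix v assume v: "v \<in> {..<n}"
  show "set (adj v) \<subseteq> {..<n}" using adj(2)[of v] v V in_arcsD2 by auto
  show "v \<notin> set (adj v)" using adj(2)[of v] v pair_no_loops[of "(v, v)"] by auto
  show "v \<in> set (adj u)" if "u \<in> set (adj v)" for u
  proof -
    have "(v, u) \<in> parcs G" using that adj(2)[of v] v by auto
    then show ?thesis using adj(2)[of u] V arcs_symmetric in_arcsD2 by auto
  qed
  have "out_arcs (with_proj G) v = Pair v ` set (adj v)"
    using adj(2)[of v] v by (auto simp: out_arcs_def)
  then have "length (adj v) = out_degree (with_proj G) v"
    using adj(1)[of v] v by (simp add: out_degree_def card_image inj_on_def distinct_card)
  also have "\<dots> \<le> max_degree G"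
    unfolding max_degree_def using v V by (intro Max_ge) auto
  finally show "length (adj v) \<le> 3" using assms(2) by simp
qed

lemma (in input_graph) indep_presented:
  assumes "presents_graph n adj G"
  shows "independent_set G I \<longleftrightarrow> indep I"
  using assms unfolding presents_graph_def independent_set_def indep_def by blast

lemma (in input_graph) max_indep_weight_presented:
  assumes "presents_graph n adj G"
  shows "max_indep_weight G w = opt w {..<n}"
proof -
  have "{I. independent_set G I} = {I. indep I \<and> I \<subseteq> {..<n}}"
    using indep_presented[OF assms] by (auto simp: indep_def)
  moreover have "set_weight w = sum w" by (simp add: fun_eq_iff set_weight_def)
  ultimately show ?thesis unfolding max_indep_weight_def opt_def by simp
qed

lemma (in input_graph) cavity_alg_chosen:
  assumes "0 < \<epsilon>"
  shows "\<exists>t \<le> Suc (depth_for \<epsilon>) + 4 + n * Suc (vertex_cost (Suc (depth_for \<epsilon>))).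
    outputs cavity_alg (input_of n adj w \<epsilon>) \<omega> t
      (chosen (\<lambda>v. w v - shift_for n \<epsilon>) (Suc (depth_for \<epsilon>)))"
proof -
  have "chosen (\<lambda>v. w v - shift_for n \<epsilon>) (Suc (depth_for \<epsilon>))
    = {v. v < n \<and> cav adj (\<lambda>v. w v - shift_for n \<epsilon>) (Suc (depth_for \<epsilon>)) {v} (adj v) < w v - shift_for n \<epsilon>}"
    by (simp add: chosen_def)
  then show ?thesis
    using cavity_alg_outputs[of n adj \<epsilon> w \<omega>] assms adj_subset deg_le_3 by simp
qed

definition time_factor :: nat where
  "time_factor = steps start_vertex + 4 * Suc (steps cav_step) + steps finish_vertex + 7"

lemma running_time_le:
  "d + 4 + n * Suc (vertex_cost d) \<le> time_factor * max 1 n * 8 ^ d"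
proof -
  let ?a = "steps start_vertex" and ?b = "Suc (steps cav_step)" and ?f = "steps finish_vertex"
  have one: "1 \<le> (8 :: nat) ^ d" by (rule one_le_power) simp
  have "d < 8 ^ d" by (rule less_exp[THEN less_le_trans]) (rule power_mono; simp)
  then have "d + 4 \<le> 5 * 8 ^ d" using one by linarith
  also have "\<dots> \<le> max 1 n * (5 * 8 ^ d)" by simp
  finally have 1: "d + 4 \<le> max 1 n * (5 * 8 ^ d)" .
  have "?a + ?f + 2 \<le> (?a + ?f + 2) * 8 ^ d" using mult_le_mono2[OF one, of "?a + ?f + 2"] by simp
  then have "Suc (vertex_cost d) \<le> (?a + 4 * ?b + ?f + 2) * 8 ^ d"
    unfolding vertex_cost_def by (simp add: algebra_simps)
  then have 2: "n * Suc (vertex_cost d) \<le> max 1 n * ((?a + 4 * ?b + ?f + 2) * 8 ^ d)"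
    by (intro mult_le_mono) simp_all
  have "max 1 n * (5 * 8 ^ d) + max 1 n * ((?a + 4 * ?b + ?f + 2) * 8 ^ d)
      = time_factor * max 1 n * 8 ^ d"
    unfolding time_factor_def by (simp only: algebra_simps)
  then show ?thesis using 1 2 by linarith
qed

text \<open>
  For \<open>\<epsilon> > 1\<close> the exponent of the required time bound is negative. It stays bounded below, so a constant factor
  makes up for it.
\<close>

lemma ln_quotient_lower:
  fixes \<epsilon> :: real
  assumes "0 < \<epsilon>"
  shows "- 1 \<le> 1 / \<epsilon>\<^sup>2 * ln (1 / \<epsilon>)"
proof -
  have "ln \<epsilon> \<le> \<epsilon> - 1" using assms by (rule ln_le_minus_one)
  also have "\<dots> \<le> \<epsilon>\<^sup>2"
  proof -
    have "0 \<le> (\<epsilon> - 1 / 2)\<^sup>2" by simp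
    then show ?thesis by (simp add: power2_eq_square algebra_simps)
  qed
  finally have "ln \<epsilon> / \<epsilon>\<^sup>2 \<le> 1" using assms by (simp add: divide_le_eq)
  then show ?thesis using assms by (simp add: ln_div)
qed

lemma eight_power_powr: "(8 :: real) ^ k = 2 powr (3 * real k)"
proof -
  have "(2 :: real) powr (3 * real k) = (2 powr 3) powr real k" by (simp only: powr_powr)
  also have "(2 :: real) powr 3 = 8" by simp
  finally show ?thesis by (simp add: powr_realpow)
qed

text \<open>
  For \<open>\<epsilon> \<le> 1 / 2\<close> the factor \<open>ln (1 / \<epsilon>)\<close> is at least \<open>ln 2\<close>, so the exponent dominates the depth, which is of
  order \<open>\<epsilon>\<^sup>-\<^sup>2\<close>. For larger \<open>\<epsilon>\<close> the depth is bounded and the constant factor suffices.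
\<close>

lemma depth_exponential:
  fixes \<epsilon> :: real
  assumes "0 < \<epsilon>"
  defines "c \<equiv> 6144 / ln 2"
  shows "8 ^ Suc (depth_for \<epsilon>) \<le> 2 powr (24582 + c) * 2 powr (c * (1 / \<epsilon>\<^sup>2 * ln (1 / \<epsilon>)))"
proof -
  define x where "x = 1 / \<epsilon>\<^sup>2"
  define y where "y = x * ln (1 / \<epsilon>)"
  have c: "0 < c" by (simp add: c_def)
  have x: "0 < x" using assms(1) by (simp add: x_def)
  have "3 * real (Suc (depth_for \<epsilon>)) = 3 * real (depth_for \<epsilon>) + 3" by simp
  moreover have "real (depth_for \<epsilon>) \<le> 2048 * x + 1"
    using depth_for_le[OF assms(1)] unfolding x_def by (simp only: times_divide_eq_right mult_1_right)
  ultimately have d: "3 * real (Suc (depth_for \<epsilon>)) \<le> 6144 * x + 6" by linarith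
  \<comment> \<open>\<open>24582 = 4 * 6144 + 6\<close> covers \<open>x \<le> 4\<close>, and the summand \<open>c\<close> covers \<open>y \<ge> - 1\<close>.\<close>
  have "3 * real (Suc (depth_for \<epsilon>)) \<le> 24582 + c + c * y"
  proof (cases "\<epsilon> \<le> 1 / 2")
    case True
    have "6144 * x = c * (x * ln 2)" by (simp add: c_def)
    also have "\<dots> \<le> c * y"
    proof -
      have "ln 2 \<le> ln (1 / \<epsilon>)" using assms(1) True by (subst ln_le_cancel_iff) (auto simp: field_simps)
      then show ?thesis using c x unfolding y_def by (intro mult_left_mono) auto
    qed
    finally show ?thesis using d c by linarith
  next
    case False
    have "(1 / 2)\<^sup>2 \<le> \<epsilon>\<^sup>2" using False by (intro power_mono) auto
    then have "x \<le> inverse ((1 / 2)\<^sup>2)"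
      unfolding x_def inverse_eq_divide by (intro divide_left_mono) (use assms(1) in auto)
    then have "x \<le> 4" by (simp add: power2_eq_square)
    moreover have "c * - 1 \<le> c * y"
      using c ln_quotient_lower[OF assms(1)] unfolding y_def x_def by (intro mult_left_mono) auto
    ultimately show ?thesis using d by linarith
  qed
  then have "(2 :: real) powr (3 * real (Suc (depth_for \<epsilon>))) \<le> 2 powr (24582 + c + c * y)"
    by (intro powr_mono) auto
  then show ?thesis unfolding eight_power_powr y_def x_def powr_add .
qed

lemma cavity_alg_time:
  "finds_indep_set_within cavity_alg (\<lambda>G. max_degree G \<le> 3)
    (\<lambda>n \<epsilon>. (time_factor * 2 powr (24582 + 6144 / ln 2)) * real (max 1 n) *
      2 powr (6144 / ln 2 * (1 / \<epsilon>\<^sup>2 * ln (1 / \<epsilon>))))"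
  unfolding finds_indep_set_within_def
proof (intro allI impI)
  fix \<epsilon> :: real and n adj G w \<omega>
  assume \<epsilon>: "0 < \<epsilon>" and G: "presents_graph n adj G" "max_degree G \<le> 3"
  let ?d = "Suc (depth_for \<epsilon>)" and ?E = "2 powr (6144 / ln 2 * (1 / \<epsilon>\<^sup>2 * ln (1 / \<epsilon>))) :: real"
  let ?C = "2 powr (24582 + 6144 / ln 2) :: real"
  interpret input_graph n adj by (rule input_graph_of_presentation[OF G])
  let ?I = "chosen (\<lambda>v. w v - shift_for n \<epsilon>) ?d"
  obtain t where t: "t \<le> ?d + 4 + n * Suc (vertex_cost ?d)" "outputs cavity_alg (input_of n adj w \<epsilon>) \<omega> t ?I"
    using cavity_alg_chosen[OF \<epsilon>] by blast
  have "real t \<le> real (time_factor * max 1 n * 8 ^ ?d)"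
    using t(1) running_time_le[of ?d n] by (intro of_nat_mono) (rule order_trans)
  also have "\<dots> = real (time_factor * max 1 n) * 8 ^ ?d" by simp
  also have "\<dots> \<le> real (time_factor * max 1 n) * (?C * ?E)"
    by (intro mult_left_mono depth_exponential \<epsilon>) simp
  also have "\<dots> = time_factor * ?C * real (max 1 n) * ?E" by (simp only: of_nat_mult mult_ac)
  finally have "real t \<le> time_factor * ?C * real (max 1 n) * ?E" .
  moreover have "independent_set G ?I"
    using indep_presented[OF G(1)] indep_chosen[OF depth_for_even] by blast
  ultimately show "\<exists>t I. outputs cavity_alg (input_of n adj w \<epsilon>) \<omega> t I \<and> independent_set G I \<and>
      real t \<le> time_factor * ?C * real (max 1 n) * ?E"
    using t(2) by blast
qed

lemma outputs_unique:
  "outputs alg inp \<omega> t I \<Longrightarrow> outputs alg inp \<omega> t' I' \<Longrightarrow> I = I'"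
  unfolding outputs_def using exec_deterministic by blast

abbreviation coins :: "(nat \<Rightarrow> bool) measure" where
  "coins \<equiv> \<Pi>\<^sub>M k\<in>UNIV. measure_pmf (bernoulli_pmf (1 / 2))"

lemma prob_space_coins: "prob_space coins"
  by (rule prob_space_PiM) (rule measure_pmf.prob_space_axioms)

lemma (in random_graph) bad_runs_cavity_alg:
  assumes "presents_graph n adj G" "0 < \<epsilon>" "\<tau> = shift_for n \<epsilon>"
  shows "bad_runs cavity_alg n adj G (exponential_law 1) \<epsilon>
    = {w \<in> space (expos n). failure (depth_for \<epsilon>) \<epsilon> w} \<times> space coins"
proof -
  have "(\<exists>t I. outputs cavity_alg (input_of n adj w \<epsilon>) \<omega> t I \<and>
        ennreal (max_indep_weight G w) / ennreal (set_weight w I) > ennreal (1 + \<epsilon>))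
      \<longleftrightarrow> failure (depth_for \<epsilon>) \<epsilon> w" for w \<omega>
  proof -
    obtain t where "outputs cavity_alg (input_of n adj w \<epsilon>) \<omega> t
        (chosen (\<lambda>v. w v - \<tau>) (Suc (depth_for \<epsilon>)))"
      using cavity_alg_chosen[OF assms(2)] unfolding assms(3) by blast
    then show ?thesis
      unfolding failure_def max_indep_weight_presented[OF assms(1)] set_weight_def
      by (metis outputs_unique)
  qed
  then show ?thesis
    unfolding bad_runs_def run_space_def by (auto simp: space_pair_measure)
qed

text \<open>
  For \<open>\<epsilon> > 1\<close> the bound is trivial. Otherwise the case distinction \<open>n \<le> depth_for \<epsilon>\<close> is the one by which the
  program chooses the shift, and in the second case \<open>n\<close> exceeds a depth of at least \<open>1500 / \<epsilon>\<^sup>2\<close>.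
\<close>

lemma bad_runs_prob:
  assumes G: "presents_graph n adj G" "max_degree G \<le> 3" and \<epsilon>: "0 < \<epsilon>"
  defines "B \<equiv> bad_runs cavity_alg n adj G (exponential_law 1) \<epsilon>"
  shows "B \<in> sets (run_space n (exponential_law 1))" "measure (run_space n (exponential_law 1)) B \<le> \<epsilon>"
proof -
  let ?R = "run_space n (exponential_law 1)" and ?d = "depth_for \<epsilon>"
  interpret input_graph n adj by (rule input_graph_of_presentation[OF G])
  interpret random_graph n adj "shift_for n \<epsilon>"
    by unfold_locales (use \<epsilon> in \<open>simp add: shift_for_def\<close>)
  interpret W: prob_space "expos n" by (rule prob_space_expos)
  interpret C: prob_space coins by (rule prob_space_coins)
  interpret R: pair_prob_space "expos n" coins ..
  let ?F = "{w \<in> space (expos n). failure ?d \<epsilon> w}"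
  have B: "B = ?F \<times> space coins"
    unfolding B_def by (rule bad_runs_cavity_alg[OF G(1) \<epsilon> refl])
  have F: "?F \<in> sets (expos n)" by (rule failure_measurable)
  show "B \<in> sets ?R"
    unfolding B run_space_def using F by (intro pair_measureI) auto
  have "emeasure ?R B = emeasure (expos n) ?F * emeasure coins (space coins)"
    unfolding B run_space_def using F by (intro C.emeasure_pair_measure_Times) auto
  also have "\<dots> = emeasure (expos n) ?F" by (simp add: C.emeasure_space_1)
  also have "\<dots> \<le> ennreal \<epsilon>"
  proof (cases "1 < \<epsilon>")
    case True
    have "emeasure (expos n) ?F \<le> 1" by (rule W.emeasure_le_1)
    also have "1 \<le> ennreal \<epsilon>" using True by simp
    finally show ?thesis .
  next
    case False
    show ?thesis
    proof (cases "n \<le> ?d")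
      case True
      then show ?thesis
        using failure_prob_small[OF depth_for_even True _ \<epsilon>] by (simp add: shift_for_def)
    next
      case large: False
      \<comment> \<open>The depth is at least \<open>2048 / \<epsilon>\<^sup>2 - 1\<close>.\<close>
      have "\<epsilon>\<^sup>2 \<le> 1" using \<epsilon> False by (simp add: power_le_one)
      moreover have "2048 \<le> real ?d * \<epsilon>\<^sup>2 + \<epsilon>\<^sup>2"
        using depth_for_large[OF \<epsilon>] by (simp add: power2_eq_square algebra_simps)
      ultimately have "1500 \<le> real ?d * \<epsilon>\<^sup>2" by linarith
      then have "1500 / \<epsilon>\<^sup>2 \<le> ?d" using \<epsilon> by (subst pos_divide_le_eq) auto
      then show ?thesis
        using large False \<epsilon> by (intro failure_prob_large[OF depth_for_even]) (auto simp: shift_for_def)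
    qed
  qed
  finally show "measure ?R B \<le> \<epsilon>"
    unfolding measure_def using \<epsilon> by (intro enn2real_leI) auto
qed

theorem theorem3:
  shows "\<exists>alg :: com.
    multiplicative_EPTAS_whp alg (\<lambda>G. max_degree G \<le> 3) (exponential_law 1) \<and>
    (\<exists>C c :: real. finds_indep_set_within alg (\<lambda>G. max_degree G \<le> 3)
       (\<lambda>n \<epsilon>. C * real (max 1 n) * 2 powr (c * ((1 / \<epsilon>\<^sup>2) * ln (1 / \<epsilon>)))))"
proof -
  let ?GC = "\<lambda>G :: nat pair_pre_digraph. max_degree G \<le> 3"
  let ?C = "time_factor * 2 powr (24582 + 6144 / ln 2) :: real" and ?c = "6144 / ln 2 :: real"
  let ?T = "\<lambda>(n :: nat) \<epsilon>. ?C * real (max 1 n) * 2 powr (?c * ((1 / \<epsilon>\<^sup>2) * ln (1 / \<epsilon>)))"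
  have time: "finds_indep_set_within cavity_alg ?GC ?T" by (rule cavity_alg_time)
  have "?T = (\<lambda>n \<epsilon>. real (max 1 n) ^ 1 * (?C * 2 powr (?c * ((1 / \<epsilon>\<^sup>2) * ln (1 / \<epsilon>)))))"
    by (simp only: fun_eq_iff power_one_right mult_ac simp_thms)
  with time have "finds_indep_set_within cavity_alg ?GC
      (\<lambda>n \<epsilon>. real (max 1 n) ^ 1 * (?C * 2 powr (?c * ((1 / \<epsilon>\<^sup>2) * ln (1 / \<epsilon>)))))"
    by (simp only:)
  then have "\<exists>k::nat. \<exists>g. finds_indep_set_within cavity_alg ?GC (\<lambda>n \<epsilon>. real (max 1 n) ^ k * g \<epsilon>)"
    by (intro exI)
  then have "multiplicative_EPTAS_whp cavity_alg ?GC (exponential_law 1)"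
    unfolding multiplicative_EPTAS_whp_def
    by (intro conjI allI impI) (assumption | (rule bad_runs_prob; assumption))+
  then show ?thesis using time by (intro exI conjI)
qed

end
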